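(* Consider the Camassa-Holm Lagrangian density $\mathcal{L}(j^2(\phi))=\frac12\big(\eta_x\eta_t^2+\eta_x^{-1}\eta_{tx}^2\big)\,dx\wedge dt$. The multisymplectic form formula yields a multi-symplectic structure $(\mathcal{M},\omega^1,\omega^0)$, with $\mathcal{M}=\mathbb{R}^6$ and $\omega^1,\omega^0$ the pre-symplectic forms on $\mathcal M$ specified in the context, such that the multisymplectic form formula becomes an intrinsic generalization of the following conservation law: for any solution $\phi\in\mathcal{P}$ and any $V,W\in\mathcal{F}$ that are $\pi_{XY}$-vertical, $$\frac{\partial}{\partial x}\,\omega^1\big(T\mathbb{F}L\cdot j^3(V),\,T\mathbb{F}L\cdot j^3(W)\big)+\frac{\partial}{\partial t}\,\omega^0\big(T\mathbb{F}L\cdot j^3(V),\,T\mathbb{F}L\cdot j^3(W)\big)=0 .$$ Moreover, the Camassa-Holm equation, both in Eulerian form $$u_t-u_{yyt}=-3uu_y+2u_yu_{yy}+uu_{yyy}$$ and in Lagrangian form $$\frac12\left(\Big(\frac{\eta_{tx}}{\eta_x}\Big)^2-\eta_t^2\right)_x-(\eta_x\eta_t)_t+\left(\frac{\eta_{tx}}{\eta_x}\right)_{xt}=0$$ (where $\frac{\partial}{\partial t}\eta(x,t)=u(t,\eta(x,t))$), is equivalent to the Hamiltonian system of equations $Z_x\lrcorner\,\omega^1+Z_t\lrcorner\,\omega^0=\nabla H(Z)$ on the multi-symplectic structure, with Hamiltonian $$H=L-p^x\eta_x-p^t\eta_t-p^{tx}\eta_{tx}.$$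
   Context: Setting: $X=S^1\times\mathbb{R}$ with coordinates $(x^1,x^0)=(x,t)$, $Y=S^1\times\mathbb{R}\times\mathbb{R}$ with coordinates $(x,t,y)$, $\pi_{XY}:Y\to X$ the projection. A section $\phi$ of $Y$ is $(x,t)\mapsto(x,t,\eta(x,t))$; $\eta(\cdot,t)$ is the Lagrangian flow of the Eulerian velocity $u$, $\partial_t\eta(x,t)=u(t,\eta(x,t))$ (so $u=\eta_t\circ\eta^{-1}$, and $\eta(\cdot,t)$ is invertible with $\eta_x\neq0$). $J^kY$ is the $k$-th jet bundle with coordinates $(x,t,\eta,\eta_x,\eta_t,\eta_{xx},\eta_{xt},\eta_{tx},\eta_{tt},\dots)$, using all ordered multi-indices (agreeing under permutation along jets of smooth sections). $L=\frac12(\eta_x\eta_t^2+\eta_x^{-1}\eta_{tx}^2)$ depends only on $\eta_x,\eta_t,\eta_{tx}$. $D_x$ denotes the formal (total) $x$-derivative on jet bundles. Momenta (functions on $J^3Y$): $p^x=\frac{\partial L}{\partial\eta_x}$, $p^t=\frac{\partial L}{\partial\eta_t}-D_x\big(\frac{\partial L}{\partial\eta_{tx}}\big)$, $p^{tx}=\frac{\partial L}{\partial\eta_{tx}}$ $(=\eta_{tx}/\eta_x)$. $\mathbb{F}L$ is the transformation from $J^3Y$ to $\mathcal{M}=\mathbb{R}^6$ (modeled over $X$) given by $(\eta,\eta_x,\eta_t,\eta_{xx},\dots)\mapsto Z=(\eta,\eta_x,\eta_t,p^x,p^t,p^{tx})$. $H$ is viewed as a function on $\mathcal{M}$ by expressing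 $\eta_{tx}$ through $p^{tx}=\eta_{tx}/\eta_x$. Multi-symplectic structure: a multi-symplectic structure consists of a phase space manifold $\mathcal{M}$ with a family of pre-symplectic forms (closed, possibly degenerate 2-forms). Here $\omega^\nu(u,v)=\langle B_\nu u,v\rangle=v^{T}B_\nu u$ on $\mathbb{R}^6$, where, with respect to the ordering $(\eta,\eta_x,\eta_t,p^x,p^t,p^{tx})$, $B_1$ is the skew-symmetric matrix whose only nonzero entries are $(B_1)_{14}=(B_1)_{36}=1$, $(B_1)_{41}=(B_1)_{63}=-1$, and $B_0$ is the skew-symmetric matrix whose only nonzero entries are $(B_0)_{15}=1$, $(B_0)_{51}=-1$. The Hamiltonian system on $(\mathcal{M},\omega^1,\omega^0,H)$ is $\omega^1(Z_x,v)+\omega^0(Z_t,v)=\langle\nabla H(Z),v\rangle$ for all $v$, i.e. $B_1Z_x+B_0Z_t=\nabla H(Z)$ for a map $Z(x,t)$ into $\mathcal{M}$; the correspondence with $\eta$ is $Z=\mathbb{F}L\circ j^3(\phi)$. Multisymplectic forms: with $\Theta_{\mathcal L}=\frac{\partial L}{\partial\eta_x}d\eta\wedge dt-\big(\frac{\partial L}{\partial\eta_t}-D_x(\frac{\partial L}{\partial\eta_{tx}})\big)d\eta\wedge dx+\frac{\partial L}{\partial\eta_{tx}}d\eta_t\wedge dt+\big(L-\frac{\partial L}{\partial\eta_x}\eta_x-\frac{\partial L}{\partial\eta_t}\eta_t-\frac{\partial L}{\partial\eta_{tx}}\eta_{tx}+D_x(\frac{\partial L}{\partial\eta_{tx}})\eta_t\big)dx\wedge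 dt$ and $\Omega_{\mathcal L}=d\Theta_{\mathcal L}$ on $J^3Y$, $\mathcal{P}$ is the set of fields $\phi$ with $j^3(\phi)^*(\mathbf{i}_W\Omega_{\mathcal L})=0$ for all vector fields $W$ on $J^3Y$ (solutions of the Euler-Lagrange equation), and for $\phi\in\mathcal{P}$, $\mathcal{F}$ is the set of variations $V$ of $\phi$ (vector fields on $Y$ along $\phi$) with $j^3(\phi)^*\pounds_{j^3(V)}[\mathbf{i}_W\Omega_{\mathcal L}]=0$ for all vector fields $W$ on $J^3Y$. Here $j^3(V)$ is the third jet prolongation: for an extension $v$ of $V$ to $Y$ with flow $\eta_Y^\lambda$ by bundle automorphisms, $j^3(V)=\frac{d}{d\lambda}|_{\lambda=0}j^3(\eta_Y^\lambda)$. $V$ is $\pi_{XY}$-vertical if $T\pi_{XY}\cdot V=0$. The multisymplectic form formula states $\int_{\partial U_X}j^3(\phi)^*[\mathbf{i}_{j^3(V)}\mathbf{i}_{j^3(W)}\Omega_{\mathcal L}]=0$ for $\phi\in\mathcal{P}$, $V,W\in\mathcal{F}$, and domains $U_X\subset X$. In the conservation law, $T\mathbb{F}L\cdot j^3(V)$ is evaluated along $j^3(\phi)$ and its components are $(V^\eta,V^{\eta_x},V^{\eta_t},V^{p^x},V^{p^t},V^{p^{tx}})$ with $V^{p}=dp\cdot j^3(V)$ for $p\in\{p^x,p^t,p^{tx}\}$. *)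

theory Defs
  imports "HOL-Analysis.Analysis"
begin

text \<open>
  Everything is written in the lifted coordinates of the universal covers. A point of
  \<open>X = S\<^sup>1 \<times> \<real>\<close> is \<open>z :: real^2\<close> with \<open>z $ 1 = x\<close> and \<open>z $ 0 = t\<close> (in the index type
  \<open>2\<close> the elements \<open>0\<close> and \<open>2\<close> coincide), and \<open>S\<^sup>1 = \<real>/\<int>\<close>, so objects on \<open>X\<close> are periodic in
  \<open>x\<close> with period 1. Since \<open>\<eta>(\<cdot>,t)\<close> is a diffeomorphism of the circle, its lift satisfies
  \<open>\<eta>(x+1,t) = \<eta>(x,t) + k\<close> with \<open>k\<close> the degree. Accordingly \<open>Y\<close> is \<open>\<real>\<^sup>3\<close> modulo the
  translation \<open>(x,t,y) \<mapsto> (x+1,t,y+k)\<close>, which as a bundle over \<open>X\<close> is isomorphic to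
  \<open>S\<^sup>1 \<times> \<real> \<times> \<real>\<close>. The degree \<open>k\<close> is an arbitrary integer parameter; \<open>k = 0\<close> gives genuinely
  periodic \<open>y\<close>-coordinates, but then no section satisfies \<open>\<eta>\<^sub>x \<noteq> 0\<close>. For \<open>k \<noteq> 0\<close> the condition
  \<open>\<eta>\<^sub>x \<noteq> 0\<close> makes every lift \<open>\<eta>(\<cdot>,t)\<close> a bijection of the line.
\<close>

subsection \<open>Smooth maps\<close>

primrec Ck :: "nat \<Rightarrow> ('a::real_normed_vector \<Rightarrow> 'b::real_normed_vector) \<Rightarrow> bool" where
  "Ck 0 f \<longleftrightarrow> continuous_on UNIV f"
| "Ck (Suc n) f \<longleftrightarrow>
     (\<forall>x. f differentiable (at x)) \<and> (\<forall>v. Ck n (\<lambda>x. frechet_derivative f (at x) v))"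

definition smooth :: "('a::real_normed_vector \<Rightarrow> 'b::real_normed_vector) \<Rightarrow> bool" where
  "smooth f \<longleftrightarrow> (\<forall>n. Ck n f)"

definition diffeo :: "('a::real_normed_vector \<Rightarrow> 'a) \<Rightarrow> bool" where
  "diffeo f \<longleftrightarrow> bij f \<and> smooth f \<and> smooth (inv f)"

definition pd :: "2 \<Rightarrow> (real^2 \<Rightarrow> 'b::real_normed_vector) \<Rightarrow> real^2 \<Rightarrow> 'b" where
  "pd \<mu> f z = frechet_derivative f (at z) (axis \<mu> 1)"


subsection \<open>Differential forms of low degree on a vector space\<close>

text \<open>A \<open>k\<close>-form takes the base point first and then \<open>k\<close> tangent vectors.\<close>

definition d0 :: "('a::real_normed_vector \<Rightarrow> real) \<Rightarrow> 'a \<Rightarrow> 'a \<Rightarrow> real" where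
  "d0 f p a = frechet_derivative f (at p) a"

definition d2 :: "('a::real_normed_vector \<Rightarrow> 'a \<Rightarrow> 'a \<Rightarrow> real) \<Rightarrow> 'a \<Rightarrow> 'a \<Rightarrow> 'a \<Rightarrow> 'a \<Rightarrow> real" where
  "d2 \<alpha> p a b c =
     frechet_derivative (\<lambda>q. \<alpha> q b c) (at p) a
   - frechet_derivative (\<lambda>q. \<alpha> q a c) (at p) b
   + frechet_derivative (\<lambda>q. \<alpha> q a b) (at p) c"

definition wedge :: "('a \<Rightarrow> 'a \<Rightarrow> real) \<Rightarrow> ('a \<Rightarrow> 'a \<Rightarrow> real) \<Rightarrow> 'a \<Rightarrow> 'a \<Rightarrow> 'a \<Rightarrow> real" where
  "wedge \<alpha> \<beta> p a b = \<alpha> p a * \<beta> p b - \<alpha> p b * \<beta> p a"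

definition interior_prod :: "('a \<Rightarrow> 'a) \<Rightarrow> ('a \<Rightarrow> 'a \<Rightarrow> 'b) \<Rightarrow> 'a \<Rightarrow> 'b" where
  "interior_prod W \<alpha> p = \<alpha> p (W p)"

definition lie2 :: "('a::real_normed_vector \<Rightarrow> 'a) \<Rightarrow> ('a \<Rightarrow> 'a \<Rightarrow> 'a \<Rightarrow> real) \<Rightarrow> 'a \<Rightarrow> 'a \<Rightarrow> 'a \<Rightarrow> real" where
  "lie2 w \<alpha> p a b =
     frechet_derivative (\<lambda>q. \<alpha> q a b) (at p) (w p)
   + \<alpha> p (frechet_derivative w (at p) a) b
   + \<alpha> p a (frechet_derivative w (at p) b)"

definition pullback1 ::
  "('b::real_normed_vector \<Rightarrow> 'a::real_normed_vector) \<Rightarrow> ('a \<Rightarrow> 'a \<Rightarrow> real) \<Rightarrow> 'b \<Rightarrow> 'b \<Rightarrow> real" where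
  "pullback1 f \<alpha> z a = \<alpha> (f z) (frechet_derivative f (at z) a)"

definition pullback2 ::
  "('b::real_normed_vector \<Rightarrow> 'a::real_normed_vector) \<Rightarrow> ('a \<Rightarrow> 'a \<Rightarrow> 'a \<Rightarrow> real) \<Rightarrow> 'b \<Rightarrow> 'b \<Rightarrow> 'b \<Rightarrow> real" where
  "pullback2 f \<alpha> z a b =
     \<alpha> (f z) (frechet_derivative f (at z) a) (frechet_derivative f (at z) b)"

definition presymplectic_form :: "('a::real_normed_vector \<Rightarrow> 'a \<Rightarrow> 'a \<Rightarrow> real) \<Rightarrow> bool" where
  "presymplectic_form \<alpha> \<longleftrightarrow>
     (\<forall>p. bounded_bilinear (\<alpha> p)) \<and> (\<forall>p a b. \<alpha> p a b = - \<alpha> p b a) \<and>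
     (\<forall>a b. smooth (\<lambda>p. \<alpha> p a b)) \<and> (\<forall>p a b c. d2 \<alpha> p a b c = 0)"

definition multisymplectic_structure ::
  "('i \<Rightarrow> 'a::real_normed_vector \<Rightarrow> 'a \<Rightarrow> 'a \<Rightarrow> real) \<Rightarrow> bool" where
  "multisymplectic_structure \<omega> \<longleftrightarrow> (\<forall>\<nu>. presymplectic_form (\<omega> \<nu>))"


subsection \<open>The bundle and its third jet bundle\<close>

type_synonym Y = "(real^2) \<times> real"

text \<open>
  Jet coordinates are indexed by ordered multi-indices: \<open>jy1 p $ \<mu> = \<eta>\<^sub>\<mu>\<close>,
  \<open>jy2 p $ \<mu> $ \<nu> = \<eta>\<^sub>\<mu>\<^sub>\<nu>\<close>, \<open>jy3 p $ \<mu> $ \<nu> $ \<kappa> = \<eta>\<^sub>\<mu>\<^sub>\<nu>\<^sub>\<kappa>\<close>.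
\<close>
type_synonym J3 = "(real^2) \<times> real \<times> (real^2) \<times> (real^2^2) \<times> (real^2^2^2)"

definition jb :: "J3 \<Rightarrow> real^2" where "jb p = fst p"
definition jy :: "J3 \<Rightarrow> real" where "jy p = fst (snd p)"
definition jy1 :: "J3 \<Rightarrow> real^2" where "jy1 p = fst (snd (snd p))"
definition jy2 :: "J3 \<Rightarrow> real^2^2" where "jy2 p = fst (snd (snd (snd p)))"
definition jy3 :: "J3 \<Rightarrow> real^2^2^2" where "jy3 p = snd (snd (snd (snd p)))"

definition deckX :: "real^2" where "deckX = axis 1 1"
definition deckY :: "int \<Rightarrow> Y" where "deckY k = (axis 1 1, of_int k)"
definition deckJ :: "int \<Rightarrow> J3" where "deckJ k = (axis 1 1, of_int k, 0, 0, 0)"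
definition deckM :: "int \<Rightarrow> real^6" where "deckM k = axis 1 (of_int k)"

definition invariant_field :: "'a::real_normed_vector \<Rightarrow> ('a \<Rightarrow> 'b::real_normed_vector) \<Rightarrow> bool" where
  "invariant_field a w \<longleftrightarrow> smooth w \<and> (\<forall>p. w (p + a) = w p)"

definition bundle_section :: "int \<Rightarrow> (real^2 \<Rightarrow> real) \<Rightarrow> bool" where
  "bundle_section k s \<longleftrightarrow> smooth s \<and> (\<forall>z. s (z + deckX) = s z + of_int k)"

definition configuration :: "int \<Rightarrow> (real^2 \<Rightarrow> real) \<Rightarrow> bool" where
  "configuration k \<eta> \<longleftrightarrow> bundle_section k \<eta> \<and> (\<forall>z. pd 1 \<eta> z \<noteq> 0)"

definition jet3 :: "(real^2 \<Rightarrow> real) \<Rightarrow> real^2 \<Rightarrow> J3" where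
  "jet3 s z =
     (z, s z, \<chi> \<mu>. pd \<mu> s z, \<chi> \<mu> \<nu>. pd \<nu> (pd \<mu> s) z, \<chi> \<mu> \<nu> \<kappa>. pd \<kappa> (pd \<nu> (pd \<mu> s)) z)"

text \<open>Formal derivative in direction \<open>\<nu>\<close>, for functions depending on jets of order at most 2.\<close>
definition Dtot :: "2 \<Rightarrow> (J3 \<Rightarrow> real) \<Rightarrow> J3 \<Rightarrow> real" where
  "Dtot \<nu> f p = frechet_derivative f (at p)
     (axis \<nu> 1, jy1 p $ \<nu>, \<chi> \<mu>. jy2 p $ \<mu> $ \<nu>, \<chi> \<mu> \<kappa>. jy3 p $ \<mu> $ \<kappa> $ \<nu>, 0)"

definition partial_y1 :: "2 \<Rightarrow> (J3 \<Rightarrow> real) \<Rightarrow> J3 \<Rightarrow> real" where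
  "partial_y1 \<mu> f p = frechet_derivative f (at p) (0, 0, axis \<mu> 1, 0, 0)"

definition partial_y2 :: "2 \<Rightarrow> 2 \<Rightarrow> (J3 \<Rightarrow> real) \<Rightarrow> J3 \<Rightarrow> real" where
  "partial_y2 \<mu> \<nu> f p = frechet_derivative f (at p) (0, 0, 0, axis \<mu> (axis \<nu> 1), 0)"


subsection \<open>Prolongation of variations\<close>

definition base_map :: "(Y \<Rightarrow> Y) \<Rightarrow> real^2 \<Rightarrow> real^2" where
  "base_map f z = fst (f (z, 0))"

definition bundle_automorphism :: "int \<Rightarrow> (Y \<Rightarrow> Y) \<Rightarrow> bool" where
  "bundle_automorphism k f \<longleftrightarrow>
     diffeo f \<and> diffeo (base_map f) \<and> (\<forall>q. fst (f q) = base_map f (fst q)) \<and>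
     (\<forall>q. f (q + deckY k) = f q + deckY k)"

text \<open>The section \<open>f \<circ> \<phi> \<circ> f\<^sub>X\<^sup>-\<^sup>1\<close>, where \<open>f\<close> covers \<open>f\<^sub>X\<close> and \<open>\<phi> = (id, s)\<close>.\<close>
definition push_section :: "(Y \<Rightarrow> Y) \<Rightarrow> (real^2 \<Rightarrow> real) \<Rightarrow> real^2 \<Rightarrow> real" where
  "push_section f s z = snd (f (inv (base_map f) z, s (inv (base_map f) z)))"

definition automorphism_flow :: "int \<Rightarrow> (Y \<Rightarrow> Y) \<Rightarrow> (real \<Rightarrow> Y \<Rightarrow> Y) \<Rightarrow> bool" where
  "automorphism_flow k v \<psi> \<longleftrightarrow>
     invariant_field (deckY k) v \<and> smooth (\<lambda>(l, q). \<psi> l q) \<and> \<psi> 0 = id \<and>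
     (\<forall>l. bundle_automorphism k (\<psi> l)) \<and>
     (\<forall>l q. ((\<lambda>l. \<psi> l q) has_vector_derivative v (\<psi> l q)) (at l))"

text \<open>
  \<open>third_prolongation k \<eta> V w\<close>: \<open>w\<close> is \<open>j\<^sup>3(V)\<close> as a vector field on \<open>J\<^sup>3Y\<close>. The map \<open>j\<^sup>3(f)\<close>
  sends \<open>j\<^sup>3(s)(z)\<close> to \<open>j\<^sup>3(f \<circ> s \<circ> f\<^sub>X\<^sup>-\<^sup>1)(f\<^sub>X(z))\<close>, so \<open>w\<close> is prescribed at the jets of
  sections, i.e. where the coordinates agree under permutation of multi-indices. At the other
  values of the redundant coordinates it is any smooth continuation; this affects neither its
  values on the image of \<open>j\<^sup>3(\<phi>)\<close> nor pull-backs by \<open>j\<^sup>3(\<phi>)\<close> of Lie derivatives along it.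
\<close>
definition third_prolongation ::
  "int \<Rightarrow> (real^2 \<Rightarrow> real) \<Rightarrow> (real^2 \<Rightarrow> Y) \<Rightarrow> (J3 \<Rightarrow> J3) \<Rightarrow> bool" where
  "third_prolongation k \<eta> V w \<longleftrightarrow>
     invariant_field (deckJ k) w \<and>
     (\<exists>v \<psi>. (\<forall>z. v (z, \<eta> z) = V z) \<and> automorphism_flow k v \<psi> \<and>
        (\<forall>s z. bundle_section k s \<longrightarrow>
           ((\<lambda>l. jet3 (push_section (\<psi> l) s) (base_map (\<psi> l) z))
              has_vector_derivative w (jet3 s z)) (at 0)))"

text \<open>Vector fields on \<open>Y\<close> along \<open>\<phi>\<close>; the second component is the fibre component.\<close>
definition variation :: "(real^2 \<Rightarrow> Y) \<Rightarrow> bool" where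
  "variation V \<longleftrightarrow> invariant_field deckX V"

definition vertical :: "(real^2 \<Rightarrow> Y) \<Rightarrow> bool" where
  "vertical V \<longleftrightarrow> (\<forall>z. fst (V z) = 0)"


subsection \<open>The Camassa--Holm Lagrangian and its multisymplectic form\<close>

definition CH_density :: "real \<Rightarrow> real \<Rightarrow> real \<Rightarrow> real" where
  "CH_density \<eta>x \<eta>t \<eta>tx = 1/2 * (\<eta>x * \<eta>t^2 + inverse \<eta>x * \<eta>tx^2)"

definition L :: "J3 \<Rightarrow> real" where
  "L p = CH_density (jy1 p $ 1) (jy1 p $ 0) (jy2 p $ 0 $ 1)"

definition px :: "J3 \<Rightarrow> real" where "px p = partial_y1 1 L p"
definition ptx :: "J3 \<Rightarrow> real" where "ptx p = partial_y2 0 1 L p"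
definition pt :: "J3 \<Rightarrow> real" where "pt p = partial_y1 0 L p - Dtot 1 ptx p"

definition Theta :: "J3 \<Rightarrow> J3 \<Rightarrow> J3 \<Rightarrow> real" where
  "Theta p a b =
     (let dx = d0 (\<lambda>p. jb p $ 1); dt = d0 (\<lambda>p. jb p $ 0);
          d\<eta> = d0 jy; d\<eta>t = d0 (\<lambda>p. jy1 p $ 0)
      in partial_y1 1 L p * wedge d\<eta> dt p a b
       - (partial_y1 0 L p - Dtot 1 (partial_y2 0 1 L) p) * wedge d\<eta> dx p a b
       + partial_y2 0 1 L p * wedge d\<eta>t dt p a b
       + (L p - partial_y1 1 L p * jy1 p $ 1 - partial_y1 0 L p * jy1 p $ 0
            - partial_y2 0 1 L p * jy2 p $ 0 $ 1
            + Dtot 1 (partial_y2 0 1 L) p * jy1 p $ 0) * wedge dx dt p a b)"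

definition Omega :: "J3 \<Rightarrow> J3 \<Rightarrow> J3 \<Rightarrow> J3 \<Rightarrow> real" where
  "Omega = d2 Theta"

text \<open>The set \<open>\<P>\<close>.\<close>
definition solution :: "int \<Rightarrow> (real^2 \<Rightarrow> real) \<Rightarrow> bool" where
  "solution k \<eta> \<longleftrightarrow> configuration k \<eta> \<and>
     (\<forall>W. invariant_field (deckJ k) W \<longrightarrow>
        (\<forall>z a b. pullback2 (jet3 \<eta>) (interior_prod W Omega) z a b = 0))"

text \<open>The set \<open>\<F>\<close> of first variations of a solution.\<close>
definition first_variation :: "int \<Rightarrow> (real^2 \<Rightarrow> real) \<Rightarrow> (real^2 \<Rightarrow> Y) \<Rightarrow> bool" where
  "first_variation k \<eta> V \<longleftrightarrow> variation V \<and>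
     (\<exists>w. third_prolongation k \<eta> V w \<and>
        (\<forall>W. invariant_field (deckJ k) W \<longrightarrow>
           (\<forall>z a b. pullback2 (jet3 \<eta>) (lie2 w (interior_prod W Omega)) z a b = 0)))"

text \<open>The integrand of the multisymplectic form formula, for \<open>jV = j\<^sup>3(V)\<close>, \<open>jW = j\<^sup>3(W)\<close>.\<close>
definition form_integrand ::
  "(real^2 \<Rightarrow> real) \<Rightarrow> (J3 \<Rightarrow> J3) \<Rightarrow> (J3 \<Rightarrow> J3) \<Rightarrow> real^2 \<Rightarrow> real^2 \<Rightarrow> real" where
  "form_integrand \<eta> jV jW = pullback1 (jet3 \<eta>) (interior_prod jV (interior_prod jW Omega))"

text \<open>
  The domains \<open>U\<^sub>X\<close> are those bounded by a piecewise \<open>C\<^sup>1\<close> Jordan curve in the plane covering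
  \<open>X\<close>; a fundamental rectangle \<open>[a,a+1] \<times> [c,d]\<close> accounts for the annulus \<open>S\<^sup>1 \<times> [c,d]\<close>,
  as its vertical sides cancel. The orientation is irrelevant for the vanishing of the integral.
\<close>
definition multisymplectic_form_formula ::
  "(real^2 \<Rightarrow> real) \<Rightarrow> (J3 \<Rightarrow> J3) \<Rightarrow> (J3 \<Rightarrow> J3) \<Rightarrow> bool" where
  "multisymplectic_form_formula \<eta> jV jW \<longleftrightarrow>
     (\<forall>\<gamma>. valid_path \<gamma> \<and> simple_path \<gamma> \<and> pathfinish \<gamma> = pathstart \<gamma> \<longrightarrow>
        ((\<lambda>s. form_integrand \<eta> jV jW (\<gamma> s) (vector_derivative \<gamma> (at s within {0..1})))
           has_integral 0) {0..1})"


subsection \<open>The multi-symplectic structure on \<open>\<real>\<^sup>6\<close>\<close>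

definition FL :: "J3 \<Rightarrow> real^6" where
  "FL p = vector [jy p, jy1 p $ 1, jy1 p $ 0, px p, pt p, ptx p]"

definition TFL :: "(J3 \<Rightarrow> J3) \<Rightarrow> J3 \<Rightarrow> real^6" where
  "TFL w p = frechet_derivative FL (at p) (w p)"

definition B :: "2 \<Rightarrow> real^6^6" where
  "B \<nu> = (\<chi> i j.
     if \<nu> = 1 then
       (if (i, j) \<in> {(1, 4), (3, 6)} then 1 else if (i, j) \<in> {(4, 1), (6, 3)} then -1 else 0)
     else (if (i, j) = (1, 5) then 1 else if (i, j) = (5, 1) then -1 else 0))"

definition omega :: "2 \<Rightarrow> real^6 \<Rightarrow> real^6 \<Rightarrow> real^6 \<Rightarrow> real" where
  "omega \<nu> p u v = (B \<nu> *v u) \<bullet> v"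

definition conservation_law :: "(real^2 \<Rightarrow> real) \<Rightarrow> (J3 \<Rightarrow> J3) \<Rightarrow> (J3 \<Rightarrow> J3) \<Rightarrow> bool" where
  "conservation_law \<eta> jV jW \<longleftrightarrow>
     (\<forall>z. pd 1 (\<lambda>z. omega 1 (FL (jet3 \<eta> z)) (TFL jV (jet3 \<eta> z)) (TFL jW (jet3 \<eta> z))) z
        + pd 0 (\<lambda>z. omega 0 (FL (jet3 \<eta> z)) (TFL jV (jet3 \<eta> z)) (TFL jW (jet3 \<eta> z))) z = 0)"

text \<open>\<open>L - p\<^sup>x\<eta>\<^sub>x - p\<^sup>t\<eta>\<^sub>t - p\<^sup>t\<^sup>x\<eta>\<^sub>t\<^sub>x\<close> with \<open>\<eta>\<^sub>t\<^sub>x = p\<^sup>t\<^sup>x\<eta>\<^sub>x\<close>.\<close>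
definition H :: "real^6 \<Rightarrow> real" where
  "H Z = (let \<eta>x = Z $ 2; \<eta>t = Z $ 3; \<eta>tx = Z $ 6 * Z $ 2
          in CH_density \<eta>x \<eta>t \<eta>tx - Z $ 4 * \<eta>x - Z $ 5 * \<eta>t - Z $ 6 * \<eta>tx)"

definition grad :: "('a::real_inner \<Rightarrow> real) \<Rightarrow> 'a \<Rightarrow> 'a" where
  "grad f p = (THE D. GDERIV f p :> D)"

definition hamiltonian_system :: "(real^2 \<Rightarrow> real^6) \<Rightarrow> bool" where
  "hamiltonian_system Z \<longleftrightarrow>
     (\<forall>z v. omega 1 (Z z) (pd 1 Z z) v + omega 0 (Z z) (pd 0 Z z) v = grad H (Z z) \<bullet> v)"


subsection \<open>The Camassa--Holm equation\<close>

definition CH_lagrangian :: "(real^2 \<Rightarrow> real) \<Rightarrow> bool" where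
  "CH_lagrangian \<eta> \<longleftrightarrow>
     (let \<eta>x = pd 1 \<eta>; \<eta>t = pd 0 \<eta>; \<eta>tx = pd 1 (pd 0 \<eta>)
      in \<forall>z. 1/2 * pd 1 (\<lambda>z. (\<eta>tx z / \<eta>x z)^2 - (\<eta>t z)^2) z
             - pd 0 (\<lambda>z. \<eta>x z * \<eta>t z) z
             + pd 0 (pd 1 (\<lambda>z. \<eta>tx z / \<eta>x z)) z = 0)"

text \<open>An Eulerian field is a function of \<open>q\<close> with \<open>q $ 1 = y\<close> and \<open>q $ 0 = t\<close>.\<close>
definition CH_eulerian :: "(real^2 \<Rightarrow> real) \<Rightarrow> bool" where
  "CH_eulerian u \<longleftrightarrow>
     (\<forall>q. pd 0 u q - pd 0 (pd 1 (pd 1 u)) q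
        = - 3 * u q * pd 1 u q + 2 * pd 1 u q * pd 1 (pd 1 u) q + u q * pd 1 (pd 1 (pd 1 u)) q)"

definition lagrangian_flow_of :: "(real^2 \<Rightarrow> real) \<Rightarrow> (real^2 \<Rightarrow> real) \<Rightarrow> bool" where
  "lagrangian_flow_of u \<eta> \<longleftrightarrow> (\<forall>z. pd 0 \<eta> z = u (\<chi> \<mu>. if \<mu> = 1 then \<eta> z else z $ 0))"

end

theory Submission
  imports Defs
begin

text \<open>
  The density \<open>L\<close> involves only \<open>\<eta>\<^sub>x\<close>, \<open>\<eta>\<^sub>t\<close> and \<open>\<eta>\<^sub>t\<^sub>x\<close>, and the coefficients of the
  Cartan form \<open>\<Theta>\<close> are the momenta and the energy \<open>e = L - p\<^sup>x\<eta>\<^sub>x - p\<^sup>t\<eta>\<^sub>t - p\<^sup>t\<^sup>x\<eta>\<^sub>t\<^sub>x\<close>. Hence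
  \<open>\<Omega> = dp\<^sup>x\<and>d\<eta>\<and>dt - dp\<^sup>t\<and>d\<eta>\<and>dx + dp\<^sup>t\<^sup>x\<and>d\<eta>\<^sub>t\<and>dt + de\<and>dx\<and>dt\<close> (\<open>Omega_formula\<close>). On two vectors
  without base component the last term vanishes and the others are, up to sign, \<open>\<omega>\<^sup>1\<close> and \<open>\<omega>\<^sup>0\<close>
  evaluated on the images under \<open>T\<F>L\<close>: the integrand of the multisymplectic form formula is
  \<open>\<omega>\<^sup>0 dx - \<omega>\<^sup>1 dt\<close> (\<open>form_integrand_formula\<close>). A smooth one-form on the plane has vanishing
  integrals over all simple loops iff it is closed (\<open>loop_integrals_vanish_iff_closed\<close>), and
  closedness of this one is the conservation law.

  For a vertical variation the flow covers the identity, so that \<open>j\<^sup>3(V)\<close> along \<open>j\<^sup>3(\<phi>)\<close> is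
  the jet of the fibre component of \<open>V\<close> (\<open>third_prolongation_vertical\<close>). Testing the
  first-variation condition with the coordinate field \<open>\<partial>/\<partial>\<eta>\<close> then gives the linearised
  Euler--Lagrange equation \<open>\<partial>\<^sub>x\<delta>p\<^sup>x + \<partial>\<^sub>t\<delta>p\<^sup>t = 0\<close> (\<open>lie_derivative_euler_lagrange\<close>). Inserting it
  into \<open>\<partial>\<^sub>x\<omega>\<^sup>1 + \<partial>\<^sub>t\<omega>\<^sup>0\<close> leaves the second derivative of \<open>L\<close> in the two variations,
  antisymmetrised, which is zero (\<open>conservation_from_linearised_equation\<close>).

  Five of the six components of the Hamiltonian system are the definitions of \<open>\<eta>\<^sub>x\<close>, \<open>\<eta>\<^sub>t\<close>,
  \<open>p\<^sup>x\<close>, \<open>p\<^sup>t\<close> and \<open>p\<^sup>t\<^sup>x\<close> in terms of \<open>\<eta>\<close>, and the remaining one is the Euler--Lagrange equation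
  \<open>\<partial>\<^sub>xp\<^sup>x + \<partial>\<^sub>tp\<^sup>t = 0\<close>, which is the Lagrangian form of the Camassa--Holm equation
  (\<open>lagrange_iff_hamilton\<close>). Substituting \<open>\<eta>\<^sub>t = u \<circ> (\<eta>, t)\<close> turns the left-hand side of the latter into
  \<open>- \<eta>\<^sub>x\<close> times the defect of the Eulerian equation at \<open>(\<eta>, t)\<close>; since \<open>\<eta>\<^sub>x \<noteq> 0\<close> and every
  \<open>\<eta>(\<cdot>, t)\<close> is onto, the two forms are equivalent (\<open>euler_iff_lagrange\<close>).
\<close>

section \<open>Smooth functions on open sets\<close>

text \<open>
  Smoothness relative to an open set, because the momenta have poles where \<open>\<eta>\<^sub>x = 0\<close>.
\<close>

primrec Ck_on :: "nat \<Rightarrow> 'a set \<Rightarrow> ('a::real_normed_vector \<Rightarrow> 'b::real_normed_vector) \<Rightarrow> bool" where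
  "Ck_on 0 S f \<longleftrightarrow> continuous_on S f"
| "Ck_on (Suc n) S f \<longleftrightarrow>
     (\<forall>x\<in>S. f differentiable (at x)) \<and> (\<forall>v. Ck_on n S (\<lambda>x. frechet_derivative f (at x) v))"

definition smooth_on :: "'a set \<Rightarrow> ('a::real_normed_vector \<Rightarrow> 'b::real_normed_vector) \<Rightarrow> bool" where
  "smooth_on S f \<longleftrightarrow> (\<forall>n. Ck_on n S f)"

lemma Ck_iff_Ck_on: "Ck n f \<longleftrightarrow> Ck_on n UNIV f"
  by (induction n arbitrary: f) auto

lemma smooth_iff_smooth_on: "smooth f \<longleftrightarrow> smooth_on UNIV f"
  by (simp add: smooth_def smooth_on_def Ck_iff_Ck_on)

lemma Ck_on_cong:
  assumes "open S" "\<And>x. x \<in> S \<Longrightarrow> f x = g x" "Ck_on n S f"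
  shows "Ck_on n S g"
  using assms(2,3)
proof (induction n arbitrary: f g)
  case 0
  then show ?case using continuous_on_cong[of S S f g] by simp
next
  case (Suc n)
  have *: "g differentiable (at x) \<and> frechet_derivative f (at x) = frechet_derivative g (at x)"
    if "x \<in> S" for x
  proof -
    have "(f has_derivative frechet_derivative f (at x)) (at x)"
      using Suc.prems(2) that by (simp add: frechet_derivative_works)
    then have "(g has_derivative frechet_derivative f (at x)) (at x)"
      by (rule has_derivative_transform_within_open[OF _ assms(1) that]) (rule Suc.prems(1))
    then show ?thesis
      using differentiableI frechet_derivative_at by blast
  qed
  have "Ck_on n S (\<lambda>x. frechet_derivative g (at x) v)" for v
    by (rule Suc.IH[of "\<lambda>x. frechet_derivative f (at x) v"]) (use * Suc.prems(2) in auto)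
  then show ?case using * by auto
qed

lemma Ck_on_SucI:
  assumes "open S" "\<And>x. x \<in> S \<Longrightarrow> (f has_derivative f' x) (at x)"
    and "\<And>v. Ck_on n S (\<lambda>x. f' x v)"
  shows "Ck_on (Suc n) S f"
proof -
  have "Ck_on n S (\<lambda>x. frechet_derivative f (at x) v)" for v
    by (rule Ck_on_cong[OF assms(1) _ assms(3)]) (simp add: frechet_derivative_at[OF assms(2), symmetric])
  moreover have "\<forall>x\<in>S. f differentiable (at x)"
    using assms(2) differentiableI by blast
  ultimately show ?thesis by simp
qed

lemma Ck_on_has_derivative:
  "Ck_on (Suc n) S f \<Longrightarrow> x \<in> S \<Longrightarrow> (f has_derivative frechet_derivative f (at x)) (at x)"
  by (simp add: frechet_derivative_works)

lemma Ck_on_Suc_lower: "Ck_on (Suc n) S f \<Longrightarrow> Ck_on n S f"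
proof (induction n arbitrary: f)
  case 0
  then show ?case
    by (auto intro!: differentiable_imp_continuous_on differentiable_at_imp_differentiable_on)
next
  case (Suc n)
  have "f differentiable (at x)" if "x \<in> S" for x
    using Suc.prems that by (simp only: Ck_on.simps)
  moreover have "Ck_on n S (\<lambda>x. frechet_derivative f (at x) v)" for v
    by (rule Suc.IH) (use Suc.prems in simp)
  ultimately show ?case by (simp only: Ck_on.simps) blast
qed

lemma Ck_on_const: "open S \<Longrightarrow> Ck_on n S (\<lambda>x. c)"
proof (induction n arbitrary: c)
  case (Suc n)
  show ?case
    by (rule Ck_on_SucI[OF Suc.prems has_derivative_const]) (rule Suc.IH[OF Suc.prems])
qed simp

lemma Ck_on_linear:
  assumes "open S" "bounded_linear h"
  shows "Ck_on n S f \<Longrightarrow> Ck_on n S (\<lambda>x. h (f x))"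
proof (induction n arbitrary: f)
  case 0
  then show ?case
    using bounded_linear.continuous_on[OF assms(2)] by simp
next
  case (Suc n)
  show ?case
  proof (rule Ck_on_SucI[OF assms(1)])
    show "((\<lambda>x. h (f x)) has_derivative (\<lambda>v. h (frechet_derivative f (at x) v))) (at x)"
      if "x \<in> S" for x
      by (rule bounded_linear.has_derivative[OF assms(2) Ck_on_has_derivative[OF Suc.prems that]])
    show "Ck_on n S (\<lambda>x. h (frechet_derivative f (at x) v))" for v
      by (rule Suc.IH) (use Suc.prems in simp)
  qed
qed

lemma Ck_on_bounded_linear:
  assumes "open S" "bounded_linear h"
  shows "Ck_on n S h"
proof (cases n)
  case 0
  then show ?thesis using bounded_linear.continuous_on[OF assms(2) continuous_on_id] by simp
next
  case (Suc m)
  show ?thesis unfolding Suc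
    by (rule Ck_on_SucI[OF assms(1) bounded_linear.has_derivative[OF assms(2) has_derivative_ident]])
      (rule Ck_on_const[OF assms(1)])
qed

lemma Ck_on_add:
  assumes "open S"
  shows "Ck_on n S f \<Longrightarrow> Ck_on n S g \<Longrightarrow> Ck_on n S (\<lambda>x. f x + g x)"
proof (induction n arbitrary: f g)
  case 0
  then show ?case by (auto intro: continuous_intros)
next
  case (Suc n)
  show ?case
  proof (rule Ck_on_SucI[OF assms(1)])
    show "((\<lambda>x. f x + g x) has_derivative
        (\<lambda>v. frechet_derivative f (at x) v + frechet_derivative g (at x) v)) (at x)"
      if "x \<in> S" for x
      using Suc.prems that by (blast intro: has_derivative_add Ck_on_has_derivative)
    show "Ck_on n S (\<lambda>x. frechet_derivative f (at x) v + frechet_derivative g (at x) v)" for v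
      by (rule Suc.IH) (use Suc.prems in simp_all)
  qed
qed

lemma Ck_on_bilinear:
  assumes "open S" "bounded_bilinear b"
  shows "Ck_on n S f \<Longrightarrow> Ck_on n S g \<Longrightarrow> Ck_on n S (\<lambda>x. b (f x) (g x))"
proof (induction n arbitrary: f g)
  case 0
  then show ?case using bounded_bilinear.continuous_on[OF assms(2)] by auto
next
  case (Suc n)
  show ?case
  proof (rule Ck_on_SucI[OF assms(1)])
    show "((\<lambda>x. b (f x) (g x)) has_derivative
        (\<lambda>v. b (f x) (frechet_derivative g (at x) v) + b (frechet_derivative f (at x) v) (g x))) (at x)"
      if "x \<in> S" for x
      by (rule bounded_bilinear.FDERIV[OF assms(2) Ck_on_has_derivative[OF Suc.prems(1) that]
            Ck_on_has_derivative[OF Suc.prems(2) that]])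
    show "Ck_on n S (\<lambda>x. b (f x) (frechet_derivative g (at x) v) +
        b (frechet_derivative f (at x) v) (g x))" for v
      by (rule Ck_on_add[OF assms(1) Suc.IH Suc.IH])
        (use Suc.prems Ck_on_Suc_lower[OF Suc.prems(1)] Ck_on_Suc_lower[OF Suc.prems(2)] in \<open>simp_all only: Ck_on.simps\<close>)
  qed
qed

lemma Ck_on_sum:
  assumes "open S" "finite I" "\<And>i. i \<in> I \<Longrightarrow> Ck_on n S (f i)"
  shows "Ck_on n S (\<lambda>x. \<Sum>i\<in>I. f i x)"
  using assms(2,3)
proof (induction I)
  case (insert i I)
  then have "Ck_on n S (f i)" "Ck_on n S (\<lambda>x. \<Sum>i\<in>I. f i x)"
    by blast+
  from Ck_on_add[OF assms(1) this] insert.hyps show ?case by simp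
qed (simp add: Ck_on_const assms(1))

lemma frechet_derivative_basis_expansion:
  fixes f :: "'a::euclidean_space \<Rightarrow> 'b::real_normed_vector"
  assumes "f differentiable (at p)"
  shows "frechet_derivative f (at p) w = (\<Sum>b\<in>Basis. (w \<bullet> b) *\<^sub>R frechet_derivative f (at p) b)"
proof -
  have "frechet_derivative f (at p) w = frechet_derivative f (at p) (\<Sum>b\<in>Basis. (w \<bullet> b) *\<^sub>R b)"
    by (simp add: euclidean_representation)
  also have "\<dots> = (\<Sum>b\<in>Basis. (w \<bullet> b) *\<^sub>R frechet_derivative f (at p) b)"
    using linear_frechet_derivative[OF assms] by (simp add: linear_sum linear_scale)
  finally show ?thesis .
qed

text \<open>
  In the directional formulation the chain rule involves \<open>D f\<close> at a moving point applied to a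
  moving vector. Expanding that vector in a basis leaves products of functions to which the
  induction hypothesis applies; this is where finite dimension enters.
\<close>

lemma Ck_on_compose:
  fixes g :: "'a::real_normed_vector \<Rightarrow> 'b::euclidean_space"
    and f :: "'b \<Rightarrow> 'c::real_normed_vector"
  assumes "open S" "g ` S \<subseteq> T"
  shows "Ck_on n T f \<Longrightarrow> Ck_on n S g \<Longrightarrow> Ck_on n S (\<lambda>x. f (g x))"
proof (induction n arbitrary: f)
  case 0
  then show ?case by (simp add: continuous_on_compose2[OF _ _ assms(2)])
next
  case (Suc n)
  let ?f' = "\<lambda>x b. frechet_derivative f (at x) b" and ?g' = "\<lambda>x v. frechet_derivative g (at x) v"
  show ?case
  proof (rule Ck_on_SucI[OF assms(1)])
    fix x assume x: "x \<in> S"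
    then have f: "(f has_derivative ?f' (g x)) (at (g x))"
      using Ck_on_has_derivative[OF Suc.prems(1)] assms(2) by auto
    have "?f' (g x) w = (\<Sum>b\<in>Basis. (w \<bullet> b) *\<^sub>R ?f' (g x) b)" for w
      by (rule frechet_derivative_basis_expansion[OF differentiableI[OF f]])
    from has_derivative_compose[OF Ck_on_has_derivative[OF Suc.prems(2) x] f, THEN has_derivative_eq_rhs, OF ext[OF this]]
    show "((\<lambda>x. f (g x)) has_derivative
        (\<lambda>v. \<Sum>b\<in>Basis. (?g' x v \<bullet> b) *\<^sub>R ?f' (g x) b)) (at x)" .
  next
    fix v
    show "Ck_on n S (\<lambda>x. \<Sum>b\<in>Basis. (?g' x v \<bullet> b) *\<^sub>R ?f' (g x) b)"
    proof (intro Ck_on_sum[OF assms(1) finite_Basis] Ck_on_bilinear[OF assms(1) bounded_bilinear_scaleR])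
      fix b :: 'b
      show "Ck_on n S (\<lambda>x. ?g' x v \<bullet> b)"
        by (rule Ck_on_linear[OF assms(1) bounded_linear_inner_left]) (use Suc.prems(2) in simp)
      show "Ck_on n S (\<lambda>x. ?f' (g x) b)"
        by (rule Suc.IH[OF _ Ck_on_Suc_lower[OF Suc.prems(2)]]) (use Suc.prems(1) in simp)
    qed
  qed
qed

lemma Ck_on_inverse:
  fixes f :: "'a::real_normed_vector \<Rightarrow> real"
  assumes "open S" "\<And>x. x \<in> S \<Longrightarrow> f x \<noteq> 0"
  shows "Ck_on n S f \<Longrightarrow> Ck_on n S (\<lambda>x. inverse (f x))"
proof (induction n)
  case 0
  then show ?case using assms by (auto intro: continuous_intros)
next
  case (Suc n)
  show ?case
  proof (rule Ck_on_SucI[OF assms(1)])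
    show "((\<lambda>x. inverse (f x)) has_derivative
        (\<lambda>v. - (inverse (f x) * frechet_derivative f (at x) v * inverse (f x)))) (at x)"
      if "x \<in> S" for x
      by (rule Deriv.has_derivative_inverse[OF assms(2)[OF that] Ck_on_has_derivative[OF Suc.prems that]])
    show "Ck_on n S (\<lambda>x. - (inverse (f x) * frechet_derivative f (at x) v * inverse (f x)))" for v
    proof -
      have "Ck_on n S (\<lambda>x. inverse (f x))" "Ck_on n S (\<lambda>x. frechet_derivative f (at x) v)"
        using Suc.IH[OF Ck_on_Suc_lower[OF Suc.prems]] Suc.prems by simp_all
      then show ?thesis
        by (intro Ck_on_linear[OF assms(1) bounded_linear_minus[OF bounded_linear_ident]]
            Ck_on_bilinear[OF assms(1) bounded_bilinear_mult])
    qed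
  qed
qed

named_theorems smooth_intros

lemma smooth_on_cong:
  "open S \<Longrightarrow> (\<And>x. x \<in> S \<Longrightarrow> f x = g x) \<Longrightarrow> smooth_on S f \<Longrightarrow> smooth_on S g"
  unfolding smooth_on_def using Ck_on_cong by blast

lemma smooth_on_has_derivative:
  "smooth_on S f \<Longrightarrow> x \<in> S \<Longrightarrow> (f has_derivative frechet_derivative f (at x)) (at x)"
  unfolding smooth_on_def using Ck_on_has_derivative by blast

lemma smooth_on_differentiable: "smooth_on S f \<Longrightarrow> x \<in> S \<Longrightarrow> f differentiable (at x)"
  by (auto simp: differentiable_def dest: smooth_on_has_derivative)

lemma smooth_on_directional_derivative [smooth_intros]:
  "smooth_on S f \<Longrightarrow> smooth_on S (\<lambda>x. frechet_derivative f (at x) v)"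
  unfolding smooth_on_def by (metis Ck_on.simps(2))

lemma smooth_on_continuous: "smooth_on S f \<Longrightarrow> continuous_on S f"
  unfolding smooth_on_def by (metis Ck_on.simps(1))

lemma smooth_on_subset: "smooth_on T f \<Longrightarrow> S \<subseteq> T \<Longrightarrow> smooth_on S f"
proof -
  have "Ck_on n T f \<Longrightarrow> S \<subseteq> T \<Longrightarrow> Ck_on n S f" for n
    by (induction n arbitrary: f) (auto intro: continuous_on_subset)
  then show "smooth_on T f \<Longrightarrow> S \<subseteq> T \<Longrightarrow> smooth_on S f"
    by (simp add: smooth_on_def)
qed

lemma smooth_on_const [smooth_intros]: "open S \<Longrightarrow> smooth_on S (\<lambda>x. c)"
  by (simp add: smooth_on_def Ck_on_const)

lemma smooth_on_linear: "open S \<Longrightarrow> bounded_linear h \<Longrightarrow> smooth_on S f \<Longrightarrow> smooth_on S (\<lambda>x. h (f x))"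
  by (simp add: smooth_on_def Ck_on_linear)

lemma smooth_on_bounded_linear: "open S \<Longrightarrow> bounded_linear h \<Longrightarrow> smooth_on S h"
  by (simp add: smooth_on_def Ck_on_bounded_linear)

lemma smooth_on_ident [smooth_intros]: "open S \<Longrightarrow> smooth_on S (\<lambda>x. x)"
  by (rule smooth_on_bounded_linear[OF _ bounded_linear_ident])

lemma smooth_on_bilinear:
  "open S \<Longrightarrow> bounded_bilinear b \<Longrightarrow> smooth_on S f \<Longrightarrow> smooth_on S g \<Longrightarrow> smooth_on S (\<lambda>x. b (f x) (g x))"
  by (simp add: smooth_on_def Ck_on_bilinear)

lemma smooth_on_add [smooth_intros]:
  "open S \<Longrightarrow> smooth_on S f \<Longrightarrow> smooth_on S g \<Longrightarrow> smooth_on S (\<lambda>x. f x + g x)"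
  by (simp add: smooth_on_def Ck_on_add)

lemma smooth_on_minus [smooth_intros]: "open S \<Longrightarrow> smooth_on S f \<Longrightarrow> smooth_on S (\<lambda>x. - f x)"
  by (rule smooth_on_linear[OF _ bounded_linear_minus[OF bounded_linear_ident]])

lemma smooth_on_diff [smooth_intros]:
  "open S \<Longrightarrow> smooth_on S f \<Longrightarrow> smooth_on S g \<Longrightarrow> smooth_on S (\<lambda>x. f x - g x)"
  using smooth_on_add[of S f "\<lambda>x. - g x"] smooth_on_minus[of S g] by simp

lemma smooth_on_mult [smooth_intros]:
  fixes f g :: "'a::real_normed_vector \<Rightarrow> real"
  shows "open S \<Longrightarrow> smooth_on S f \<Longrightarrow> smooth_on S g \<Longrightarrow> smooth_on S (\<lambda>x. f x * g x)"
  by (rule smooth_on_bilinear[OF _ bounded_bilinear_mult])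

lemma smooth_on_scaleR [smooth_intros]:
  "open S \<Longrightarrow> smooth_on S f \<Longrightarrow> smooth_on S g \<Longrightarrow> smooth_on S (\<lambda>x. f x *\<^sub>R g x)"
  by (rule smooth_on_bilinear[OF _ bounded_bilinear_scaleR])

lemma smooth_on_power [smooth_intros]:
  fixes f :: "'a::real_normed_vector \<Rightarrow> real"
  shows "open S \<Longrightarrow> smooth_on S f \<Longrightarrow> smooth_on S (\<lambda>x. f x ^ n)"
  by (induction n) (auto intro: smooth_intros)

lemma smooth_on_sum [smooth_intros]:
  "open S \<Longrightarrow> finite I \<Longrightarrow> (\<And>i. i \<in> I \<Longrightarrow> smooth_on S (f i)) \<Longrightarrow> smooth_on S (\<lambda>x. \<Sum>i\<in>I. f i x)"
  by (simp add: smooth_on_def Ck_on_sum)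

lemma smooth_on_compose:
  fixes g :: "'a::real_normed_vector \<Rightarrow> 'b::euclidean_space"
  shows "smooth_on T f \<Longrightarrow> open S \<Longrightarrow> smooth_on S g \<Longrightarrow> g ` S \<subseteq> T \<Longrightarrow> smooth_on S (\<lambda>x. f (g x))"
  by (simp add: smooth_on_def Ck_on_compose)

lemma smooth_on_divide [smooth_intros]:
  fixes f g :: "'a::real_normed_vector \<Rightarrow> real"
  assumes "open S" "smooth_on S f" "smooth_on S g" "\<And>x. x \<in> S \<Longrightarrow> g x \<noteq> 0"
  shows "smooth_on S (\<lambda>x. f x / g x)"
proof -
  have "smooth_on S (\<lambda>x. inverse (g x))"
    using assms by (simp add: smooth_on_def Ck_on_inverse)
  then show ?thesis
    using smooth_on_mult[OF assms(1,2)] by (simp add: divide_inverse)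
qed

lemma smooth_on_fst [smooth_intros]: "open S \<Longrightarrow> smooth_on S f \<Longrightarrow> smooth_on S (\<lambda>x. fst (f x))"
  by (rule smooth_on_linear[OF _ bounded_linear_fst])

lemma smooth_on_snd [smooth_intros]: "open S \<Longrightarrow> smooth_on S f \<Longrightarrow> smooth_on S (\<lambda>x. snd (f x))"
  by (rule smooth_on_linear[OF _ bounded_linear_snd])

lemma smooth_on_nth [smooth_intros]:
  "open S \<Longrightarrow> smooth_on S f \<Longrightarrow> smooth_on S (\<lambda>x. f x $ i)"
  by (rule smooth_on_linear[OF _ bounded_linear_vec_nth])

lemma smooth_on_Pair [smooth_intros]:
  assumes "open S" "smooth_on S f" "smooth_on S g"
  shows "smooth_on S (\<lambda>x. (f x, g x))"
proof -
  have "smooth_on S (\<lambda>x. (f x, 0) + (0, g x))"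
    using assms by (intro smooth_on_add smooth_on_linear[OF assms(1) bounded_linear_Pair[OF bounded_linear_ident bounded_linear_zero]]
        smooth_on_linear[OF assms(1) bounded_linear_Pair[OF bounded_linear_zero bounded_linear_ident]])
  then show ?thesis by simp
qed

lemma bounded_linear_axis: "bounded_linear (axis i :: 'a::real_normed_vector \<Rightarrow> 'a^'n::finite)"
  by (rule bounded_linear_intro[where K = 1])
    (auto simp: vec_eq_iff axis_def norm_vec_def L2_set_def if_distrib if_distribR sum.delta cong: if_cong)

lemma smooth_on_vec [smooth_intros]:
  fixes f :: "'n::finite \<Rightarrow> 'a::real_normed_vector \<Rightarrow> 'b::real_normed_vector"
  assumes "open S" "\<And>i. smooth_on S (f i)"
  shows "smooth_on S (\<lambda>x. \<chi> i. f i x)"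
proof -
  have "(\<chi> i. f i x) = (\<Sum>i\<in>UNIV. axis i (f i x))" for x
    by (auto simp: vec_eq_iff axis_def sum.delta if_distrib if_distribR cong: if_cong)
  moreover have "smooth_on S (\<lambda>x. \<Sum>i\<in>UNIV. axis i (f i x))"
    using assms by (intro smooth_on_sum smooth_on_linear[OF assms(1) bounded_linear_axis]) auto
  ultimately show ?thesis by simp
qed

section \<open>Second derivatives and partial derivatives\<close>

lemma directional_derivative_along_line:
  assumes "smooth_on S f" "p + s *\<^sub>R a \<in> S"
  shows "((\<lambda>s. f (p + s *\<^sub>R a)) has_real_derivative frechet_derivative f (at (p + s *\<^sub>R a)) a) (at s)"
proof -
  note D = smooth_on_has_derivative[OF assms]
  have "((\<lambda>s. p + s *\<^sub>R a) has_derivative (\<lambda>h. h *\<^sub>R a)) (at s)"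
    by (auto intro!: derivative_eq_intros)
  from has_derivative_compose[OF this D] show ?thesis
    by (simp add: has_field_derivative_def linear_scale[OF has_derivative_linear[OF D]] mult_commute_abs)
qed

text \<open>
  Two applications of the mean value theorem: one in the direction \<open>a\<close> to the difference of
  \<open>f\<close> at a shift by \<open>h b\<close>, one in the direction \<open>b\<close> to the resulting increment.
\<close>

lemma second_difference_mean_value:
  fixes f :: "'a::real_normed_vector \<Rightarrow> real"
  assumes f: "smooth_on (ball p r) f" and h: "0 < h" "h * (norm a + norm b) < r"
  shows "\<exists>q. dist p q \<le> h * (norm a + norm b) \<and>
    f (p + h *\<^sub>R a + h *\<^sub>R b) - f (p + h *\<^sub>R a) - f (p + h *\<^sub>R b) + f p =
      h\<^sup>2 * frechet_derivative (\<lambda>x. frechet_derivative f (at x) a) (at q) b"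
proof -
  let ?D = "\<lambda>x. frechet_derivative f (at x) a"
  have bound: "norm (s *\<^sub>R a + t *\<^sub>R b) \<le> h * (norm a + norm b)"
    if "0 \<le> s" "s \<le> h" "0 \<le> t" "t \<le> h" for s t
  proof -
    have "norm (s *\<^sub>R a + t *\<^sub>R b) \<le> s * norm a + t * norm b"
      using norm_triangle_ineq[of "s *\<^sub>R a" "t *\<^sub>R b"] that by simp
    also have "\<dots> \<le> h * norm a + h * norm b"
      using that by (intro add_mono mult_right_mono) auto
    finally show ?thesis by (simp add: distrib_left)
  qed
  have near: "p + s *\<^sub>R a + t *\<^sub>R b \<in> ball p r" if "0 \<le> s" "s \<le> h" "0 \<le> t" "t \<le> h" for s t
    using bound[OF that] h(2) by (simp add: dist_norm algebra_simps norm_minus_commute flip: minus_add_distrib)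
  have "((\<lambda>s. f (p + s *\<^sub>R a + h *\<^sub>R b) - f (p + s *\<^sub>R a)) has_real_derivative
      ?D (p + s *\<^sub>R a + h *\<^sub>R b) - ?D (p + s *\<^sub>R a)) (at s)" if "0 \<le> s" "s \<le> h" for s
    using directional_derivative_along_line[OF f, of "p + h *\<^sub>R b" s a]
      directional_derivative_along_line[OF f, of p s a] near[OF that, of h] near[OF that, of 0] h(1)
    by (intro DERIV_diff) (simp_all add: add.assoc add.commute[of "h *\<^sub>R b"])
  from MVT2[OF h(1) this] obtain s where s: "0 < s" "s < h"
    and 1: "f (p + h *\<^sub>R a + h *\<^sub>R b) - f (p + h *\<^sub>R a) - (f (p + h *\<^sub>R b) - f p) =
      h * (?D (p + s *\<^sub>R a + h *\<^sub>R b) - ?D (p + s *\<^sub>R a))"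
    by auto
  have "((\<lambda>t. ?D (p + s *\<^sub>R a + t *\<^sub>R b)) has_real_derivative
      frechet_derivative ?D (at (p + s *\<^sub>R a + t *\<^sub>R b)) b) (at t)" if "0 \<le> t" "t \<le> h" for t
    using directional_derivative_along_line[OF smooth_on_directional_derivative[OF f]] near[of s t] s that
    by simp
  from MVT2[OF h(1) this] obtain t where t: "0 < t" "t < h"
    and 2: "?D (p + s *\<^sub>R a + h *\<^sub>R b) - ?D (p + s *\<^sub>R a) =
      h * frechet_derivative ?D (at (p + s *\<^sub>R a + t *\<^sub>R b)) b"
    by auto
  show ?thesis
  proof (intro exI conjI)
    show "dist p (p + s *\<^sub>R a + t *\<^sub>R b) \<le> h * (norm a + norm b)"
      using bound[of s t] s t by (simp add: dist_norm algebra_simps norm_minus_commute flip: minus_add_distrib)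
    show "f (p + h *\<^sub>R a + h *\<^sub>R b) - f (p + h *\<^sub>R a) - f (p + h *\<^sub>R b) + f p =
        h\<^sup>2 * frechet_derivative ?D (at (p + s *\<^sub>R a + t *\<^sub>R b)) b"
      using 1 unfolding 2 by (simp add: power2_eq_square)
  qed
qed

text \<open>
  The second difference is symmetric in \<open>a\<close> and \<open>b\<close>; as the step tends to zero its two
  mean-value representations tend to the two iterated derivatives.
\<close>

lemma second_derivative_symmetric:
  fixes f :: "'a::real_normed_vector \<Rightarrow> real"
  assumes f: "smooth_on S f" and S: "open S" "p \<in> S"
  shows "frechet_derivative (\<lambda>x. frechet_derivative f (at x) a) (at p) b =
    frechet_derivative (\<lambda>x. frechet_derivative f (at x) b) (at p) a"
proof (rule ccontr)
  define A where "A = (\<lambda>x. frechet_derivative (\<lambda>x. frechet_derivative f (at x) a) (at x) b)"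
  define C where "C = (\<lambda>x. frechet_derivative (\<lambda>x. frechet_derivative f (at x) b) (at x) a)"
  assume "\<not> ?thesis"
  then have "A p \<noteq> C p" by (simp add: A_def C_def)
  define e where "e = \<bar>A p - C p\<bar> / 2"
  have e: "e > 0" using \<open>A p \<noteq> C p\<close> by (simp add: e_def)
  have "continuous_on S A" "continuous_on S C"
    unfolding A_def C_def by (intro smooth_on_continuous smooth_on_directional_derivative f)+
  then have "isCont A p" "isCont C p"
    using S continuous_on_eq_continuous_at by blast+
  then obtain r1 r2 where r: "r1 > 0" "r2 > 0"
    "\<And>x. dist x p < r1 \<Longrightarrow> dist (A x) (A p) < e" "\<And>x. dist x p < r2 \<Longrightarrow> dist (C x) (C p) < e"
    using e unfolding continuous_at_eps_delta by metis
  obtain r3 where r3: "r3 > 0" "ball p r3 \<subseteq> S"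
    using S open_contains_ball by blast
  define R where "R = min r1 (min r2 r3)"
  \<comment> \<open>The summand 1 keeps the denominator positive when both vectors vanish.\<close>
  define h where "h = R / (2 * (norm a + norm b + 1))"
  have R: "R > 0" using r r3 by (simp add: R_def)
  have n: "0 < 2 * (norm a + norm b + 1)"
    by (simp add: add_nonneg_pos)
  have h: "h > 0" unfolding h_def using R n by (rule divide_pos_pos)
  have "h * (norm a + norm b) < R"
  proof -
    have "h * (norm a + norm b) \<le> h * (norm a + norm b + 1)"
      using h by (intro mult_left_mono) auto
    also have "\<dots> = R / 2" using n by (simp add: h_def field_simps)
    also have "\<dots> < R" using R by simp
    finally show ?thesis .
  qed
  then have hR: "h * (norm a + norm b) < R" "h * (norm b + norm a) < R"
    by (simp_all add: add.commute)
  have fR: "smooth_on (ball p R) f"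
    by (rule smooth_on_subset[OF f]) (use r3 in \<open>auto simp: R_def\<close>)
  obtain q1 where q1: "dist p q1 \<le> h * (norm a + norm b)"
    and eq1: "f (p + h *\<^sub>R a + h *\<^sub>R b) - f (p + h *\<^sub>R a) - f (p + h *\<^sub>R b) + f p = h\<^sup>2 * A q1"
    unfolding A_def using second_difference_mean_value[OF fR h hR(1)] by blast
  obtain q2 where q2: "dist p q2 \<le> h * (norm b + norm a)"
    and eq2: "f (p + h *\<^sub>R b + h *\<^sub>R a) - f (p + h *\<^sub>R b) - f (p + h *\<^sub>R a) + f p = h\<^sup>2 * C q2"
    unfolding C_def using second_difference_mean_value[OF fR h hR(2)] by blast
  have "p + h *\<^sub>R b + h *\<^sub>R a = p + h *\<^sub>R a + h *\<^sub>R b"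
    by (simp add: algebra_simps)
  with eq2 have "f (p + h *\<^sub>R a + h *\<^sub>R b) - f (p + h *\<^sub>R b) - f (p + h *\<^sub>R a) + f p = h\<^sup>2 * C q2"
    by metis
  with eq1 have "h\<^sup>2 * A q1 = h\<^sup>2 * C q2" by linarith
  then have "A q1 = C q2" using h by simp
  moreover have "dist (A q1) (A p) < e" "dist (C q2) (C p) < e"
    using q1 q2 hR r(3)[of q1] r(4)[of q2] by (auto simp: R_def dist_commute)
  ultimately show False
    unfolding e_def dist_real_def by (auto simp: abs_if field_simps split: if_splits)
qed

lemma smooth_on_derivative_along:
  fixes f :: "'b::euclidean_space \<Rightarrow> 'c::real_normed_vector"
  assumes "open T" "smooth_on S f" "smooth_on T J" "\<And>z. z \<in> T \<Longrightarrow> J z \<in> S" "smooth_on T w"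
  shows "smooth_on T (\<lambda>z. frechet_derivative f (at (J z)) (w z))"
proof (rule smooth_on_cong[OF assms(1)])
  show "(\<Sum>b\<in>Basis. (w z \<bullet> b) *\<^sub>R frechet_derivative f (at (J z)) b) =
      frechet_derivative f (at (J z)) (w z)" if "z \<in> T" for z
    by (rule frechet_derivative_basis_expansion[symmetric])
      (rule smooth_on_differentiable[OF assms(2) assms(4)[OF that]])
  show "smooth_on T (\<lambda>z. \<Sum>b\<in>Basis. (w z \<bullet> b) *\<^sub>R frechet_derivative f (at (J z)) b)"
  proof (intro smooth_on_sum smooth_on_scaleR assms(1) finite_Basis)
    fix b :: 'b
    show "smooth_on T (\<lambda>z. w z \<bullet> b)"
      by (rule smooth_on_linear[OF assms(1) bounded_linear_inner_left assms(5)])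
    show "smooth_on T (\<lambda>z. frechet_derivative f (at (J z)) b)"
      by (rule smooth_on_compose[OF smooth_on_directional_derivative[OF assms(2)] assms(1,3)])
        (use assms(4) in blast)
  qed
qed

text \<open>
  Product rule for a differential paired with a vector field along a map: both its base point
  and its argument move.
\<close>

lemma has_derivative_derivative_along:
  fixes f :: "'b::euclidean_space \<Rightarrow> 'c::real_normed_vector"
    and J w :: "'a::real_normed_vector \<Rightarrow> 'b"
  assumes f: "open S" "smooth_on S f" and JS: "\<And>z. J z \<in> S"
    and J: "(J has_derivative J') (at z)" and w: "(w has_derivative w') (at z)"
  shows "((\<lambda>z. frechet_derivative f (at (J z)) (w z)) has_derivative
    (\<lambda>a. frechet_derivative (\<lambda>q. frechet_derivative f (at q) (w z)) (at (J z)) (J' a)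
       + frechet_derivative f (at (J z)) (w' a))) (at z)"
proof -
  let ?D = "\<lambda>b q. frechet_derivative f (at q) b"
  have e: "?D v q = (\<Sum>b\<in>Basis. (v \<bullet> b) *\<^sub>R ?D b q)" if "q \<in> S" for v q
    by (rule frechet_derivative_basis_expansion) (rule smooth_on_differentiable[OF f(2) that])
  have D2: "(?D b has_derivative frechet_derivative (?D b) (at (J z))) (at (J z))" for b
    by (rule smooth_on_has_derivative[OF smooth_on_directional_derivative[OF f(2)] JS])
  have "((\<lambda>z. \<Sum>b\<in>Basis. (w z \<bullet> b) *\<^sub>R ?D b (J z)) has_derivative
      (\<lambda>a. \<Sum>b\<in>Basis. (w z \<bullet> b) *\<^sub>R frechet_derivative (?D b) (at (J z)) (J' a)
        + (w' a \<bullet> b) *\<^sub>R ?D b (J z))) (at z)"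
    by (intro has_derivative_sum has_derivative_scaleR has_derivative_inner_left w
        has_derivative_compose[OF J D2])
  moreover have "frechet_derivative (?D (w z)) (at (J z)) (J' a) =
      (\<Sum>b\<in>Basis. (w z \<bullet> b) *\<^sub>R frechet_derivative (?D b) (at (J z)) (J' a))" for a
  proof -
    have "((\<lambda>q. \<Sum>b\<in>Basis. (w z \<bullet> b) *\<^sub>R ?D b q) has_derivative
        (\<lambda>x. \<Sum>b\<in>Basis. (w z \<bullet> b) *\<^sub>R frechet_derivative (?D b) (at (J z)) x)) (at (J z))"
      by (intro has_derivative_sum has_derivative_scaleR_right D2)
    from has_derivative_transform_within_open[OF this f(1) JS e[symmetric]]
    have "(?D (w z) has_derivative (\<lambda>x. \<Sum>b\<in>Basis. (w z \<bullet> b) *\<^sub>R frechet_derivative (?D b) (at (J z)) x)) (at (J z))" .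
    from fun_cong[OF frechet_derivative_at[OF this], symmetric] show ?thesis .
  qed
  moreover have "(\<lambda>z. ?D (w z) (J z)) = (\<lambda>z. \<Sum>b\<in>Basis. (w z \<bullet> b) *\<^sub>R ?D b (J z))"
    using e[OF JS] by (rule ext)
  moreover have "?D (w' a) (J z) = (\<Sum>b\<in>Basis. (w' a \<bullet> b) *\<^sub>R ?D b (J z))" for a
    by (rule e[OF JS])
  ultimately show ?thesis
    by (simp only: sum.distrib)
qed


lemma UNIV_index2: "(UNIV :: 2 set) = {1, 0}"
  using exhaust_2[of 0] by (auto simp: UNIV_2)

lemma index2_exhaust: "\<mu> = 1 \<or> \<mu> = (0::2)"
  using UNIV_index2 by blast

lemma sum_index2: "(\<Sum>\<mu>\<in>(UNIV::2 set). f \<mu>) = f 1 + f 0"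
  by (simp add: UNIV_index2)

text \<open>
  The coordinates in \<open>real^2\<close> are labelled \<open>1\<close> (space) and \<open>0\<close> (time) throughout.
\<close>

lemma vec2_decomp: "a = (a $ 1) *\<^sub>R axis 1 1 + (a $ 0) *\<^sub>R axis (0::2) (1::real)"
  using index2_exhaust by (auto simp: vec_eq_iff axis_def)

lemma pd_eqI: "(f has_derivative f') (at z) \<Longrightarrow> pd \<mu> f z = f' (axis \<mu> 1)"
  by (simp add: pd_def frechet_derivative_at[symmetric])

lemma frechet_derivative_via_pd:
  assumes "f differentiable (at z)"
  shows "frechet_derivative f (at z) a = (a $ 1) *\<^sub>R pd 1 f z + (a $ 0) *\<^sub>R pd 0 f z"
proof -
  have l: "linear (frechet_derivative f (at z))"
    by (rule linear_frechet_derivative[OF assms])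
  show ?thesis
    by (subst vec2_decomp[of a]) (simp add: pd_def linear_add[OF l] linear_scale[OF l])
qed

lemma has_derivative_via_pd:
  assumes "f differentiable (at z)"
  shows "(f has_derivative (\<lambda>a. (a $ 1) *\<^sub>R pd 1 f z + (a $ 0) *\<^sub>R pd 0 f z)) (at z)"
proof -
  have "frechet_derivative f (at z) = (\<lambda>a. (a $ 1) *\<^sub>R pd 1 f z + (a $ 0) *\<^sub>R pd 0 f z)"
    using frechet_derivative_via_pd[OF assms] by (rule ext)
  with assms show ?thesis by (simp only: frechet_derivative_works)
qed

lemma pd_const: "pd \<mu> (\<lambda>z. c) z = 0"
  by (simp add: pd_def)

lemma pd_add:
  assumes "f differentiable (at z)" "g differentiable (at z)"
  shows "pd \<mu> (\<lambda>z. f z + g z) z = pd \<mu> f z + pd \<mu> g z"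
  unfolding pd_def using assms
  by (subst frechet_derivative_at[symmetric, OF has_derivative_add]) (auto simp: frechet_derivative_works)

lemma pd_diff:
  assumes "f differentiable (at z)" "g differentiable (at z)"
  shows "pd \<mu> (\<lambda>z. f z - g z) z = pd \<mu> f z - pd \<mu> g z"
  unfolding pd_def using assms
  by (subst frechet_derivative_at[symmetric, OF has_derivative_diff]) (auto simp: frechet_derivative_works)

lemma pd_minus:
  assumes "f differentiable (at z)"
  shows "pd \<mu> (\<lambda>z. - f z) z = - pd \<mu> f z"
  unfolding pd_def using assms
  by (subst frechet_derivative_at[symmetric, OF has_derivative_minus]) (auto simp: frechet_derivative_works)

lemma pd_mult:
  fixes f g :: "real^2 \<Rightarrow> real"
  assumes "f differentiable (at z)" "g differentiable (at z)"
  shows "pd \<mu> (\<lambda>z. f z * g z) z = f z * pd \<mu> g z + pd \<mu> f z * g z"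
  unfolding pd_def using assms
  by (subst frechet_derivative_at[symmetric, OF has_derivative_mult]) (auto simp: frechet_derivative_works)

lemma pd_power2:
  fixes f :: "real^2 \<Rightarrow> real"
  assumes "f differentiable (at z)"
  shows "pd \<mu> (\<lambda>z. (f z)\<^sup>2) z = 2 * f z * pd \<mu> f z"
  using pd_mult[OF assms assms] by (simp add: power2_eq_square)

lemma pd_divide:
  fixes f g :: "real^2 \<Rightarrow> real"
  assumes "f differentiable (at z)" "g differentiable (at z)" "g z \<noteq> 0"
  shows "pd \<mu> (\<lambda>z. f z / g z) z = pd \<mu> f z / g z - f z * pd \<mu> g z / (g z)\<^sup>2"
proof -
  have "((\<lambda>z. f z / g z) has_derivative (\<lambda>h. - f z * (inverse (g z) * frechet_derivative g (at z) h * inverse (g z))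
      + frechet_derivative f (at z) h / g z)) (at z)"
    using assms by (intro has_derivative_divide) (auto simp: frechet_derivative_works)
  from pd_eqI[OF this] show ?thesis
    using assms(3) by (simp add: pd_def field_simps power2_eq_square)
qed

lemma pd_vec_nth:
  assumes "f differentiable (at z)"
  shows "pd \<mu> (\<lambda>z. f z $ i) z = pd \<mu> f z $ i"
  unfolding pd_def using assms
  by (subst frechet_derivative_at[symmetric, OF bounded_linear.has_derivative[OF bounded_linear_vec_nth]])
    (auto simp: frechet_derivative_works)

lemma smooth_on_pd [smooth_intros]: "smooth_on UNIV f \<Longrightarrow> smooth_on UNIV (pd \<mu> f)"
  using smooth_on_directional_derivative[of UNIV f "axis \<mu> 1"] by (simp add: pd_def[abs_def])

lemma pd_commute:
  fixes f :: "real^2 \<Rightarrow> real"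
  assumes "smooth_on UNIV f"
  shows "pd \<mu> (pd \<nu> f) z = pd \<nu> (pd \<mu> f) z"
  using second_derivative_symmetric[OF assms, of z] by (simp add: pd_def[abs_def])

lemma pd_has_real_derivative_axis:
  assumes "f differentiable (at (z + s *\<^sub>R axis \<mu> 1))"
  shows "((\<lambda>s. f (z + s *\<^sub>R axis \<mu> 1)) has_vector_derivative pd \<mu> f (z + s *\<^sub>R axis \<mu> 1)) (at s)"
proof -
  have "((\<lambda>s. z + s *\<^sub>R axis \<mu> 1) has_derivative (\<lambda>h. h *\<^sub>R axis \<mu> 1)) (at s)"
    by (auto intro!: derivative_eq_intros)
  from has_derivative_compose[OF this assms[unfolded frechet_derivative_works]] show ?thesis
    by (simp add: has_vector_derivative_def pd_def linear_scale[OF linear_frechet_derivative[OF assms]])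
qed

section \<open>Momenta and the multisymplectic form in jet coordinates\<close>

lemma bounded_linear_jets:
  "bounded_linear jb" "bounded_linear jy" "bounded_linear jy1" "bounded_linear jy2" "bounded_linear jy3"
proof -
  have *: "jb = (\<lambda>p. fst p)" "jy = (\<lambda>p. fst (snd p))" "jy1 = (\<lambda>p. fst (snd (snd p)))"
    "jy2 = (\<lambda>p. fst (snd (snd (snd p))))" "jy3 = (\<lambda>p. snd (snd (snd (snd p))))"
    by (auto simp: jb_def jy_def jy1_def jy2_def jy3_def)
  show "bounded_linear jb" "bounded_linear jy" "bounded_linear jy1" "bounded_linear jy2" "bounded_linear jy3"
    unfolding * by (intro bounded_linear_compose[OF bounded_linear_fst] bounded_linear_compose[OF bounded_linear_snd] bounded_linear_ident)+
qed

lemmas smooth_on_jets [smooth_intros] = bounded_linear_jets[THEN smooth_on_linear[rotated]]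

lemma has_derivative_jet_coordinates:
  "(jy has_derivative jy) F"
  "((\<lambda>p. jb p $ i) has_derivative (\<lambda>a. jb a $ i)) F"
  "((\<lambda>p. jy1 p $ i) has_derivative (\<lambda>a. jy1 a $ i)) F"
  "((\<lambda>p. jy2 p $ i $ j) has_derivative (\<lambda>a. jy2 a $ i $ j)) F"
  "((\<lambda>p. jy3 p $ i $ j $ k) has_derivative (\<lambda>a. jy3 a $ i $ j $ k)) F"
  by (intro bounded_linear_imp_has_derivative bounded_linear_jets
      bounded_linear_compose[OF bounded_linear_vec_nth])+

lemma jet_coordinates_tuple [simp]:
  "jb (b, y, y1, y2, y3) = b" "jy (b, y, y1, y2, y3) = y" "jy1 (b, y, y1, y2, y3) = y1"
  "jy2 (b, y, y1, y2, y3) = y2" "jy3 (b, y, y1, y2, y3) = y3"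
  by (simp_all add: jb_def jy_def jy1_def jy2_def jy3_def)

text \<open>
  The open set of jets on which the density and the momenta are smooth; it contains the jets of
  all configurations.
\<close>

definition regular_jets :: "J3 set" where
  "regular_jets = {p. jy1 p $ 1 \<noteq> 0}"

lemma open_regular_jets: "open regular_jets"
proof -
  have "continuous_on UNIV (\<lambda>p. jy1 p $ 1)"
    by (intro smooth_on_continuous smooth_intros) simp_all
  then have "open ((\<lambda>p. jy1 p $ 1) -` (- {0}) \<inter> UNIV)"
    by (rule continuous_on_open_vimage[THEN iffD1, rule_format, rotated]) auto
  then show ?thesis by (simp add: regular_jets_def vimage_def)
qed

lemma L_has_derivative:
  assumes "p \<in> regular_jets"
  shows "(L has_derivative (\<lambda>a. 1/2 * ((jy1 p $ 0)\<^sup>2 - (jy2 p $ 0 $ 1 / jy1 p $ 1)\<^sup>2) * jy1 a $ 1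
    + jy1 p $ 1 * jy1 p $ 0 * jy1 a $ 0 + jy2 p $ 0 $ 1 / jy1 p $ 1 * jy2 a $ 0 $ 1)) (at p)"
proof -
  have nz: "jy1 p $ 1 \<noteq> 0" using assms by (simp add: regular_jets_def)
  show ?thesis
    unfolding L_def[abs_def] CH_density_def
    by (rule has_derivative_jet_coordinates derivative_eq_intros refl nz)+
      (use nz in \<open>auto simp: fun_eq_iff field_simps power2_eq_square\<close>)
qed

lemma px_formula:
  assumes "p \<in> regular_jets"
  shows "px p = 1/2 * ((jy1 p $ 0)\<^sup>2 - (jy2 p $ 0 $ 1 / jy1 p $ 1)\<^sup>2)"
  unfolding px_def partial_y1_def frechet_derivative_at[OF L_has_derivative[OF assms], symmetric]
  by (simp add: axis_def)

lemma partial_L_t_formula: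
  assumes "p \<in> regular_jets"
  shows "partial_y1 0 L p = jy1 p $ 1 * jy1 p $ 0"
  unfolding partial_y1_def frechet_derivative_at[OF L_has_derivative[OF assms], symmetric]
  by (simp add: axis_def)

lemma ptx_formula:
  assumes "p \<in> regular_jets"
  shows "ptx p = jy2 p $ 0 $ 1 / jy1 p $ 1"
  unfolding ptx_def partial_y2_def frechet_derivative_at[OF L_has_derivative[OF assms], symmetric]
  by (simp add: axis_def)

lemma ptx_has_derivative:
  assumes "p \<in> regular_jets"
  shows "(ptx has_derivative (\<lambda>a. jy2 a $ 0 $ 1 / jy1 p $ 1
    - jy2 p $ 0 $ 1 * jy1 a $ 1 / (jy1 p $ 1)\<^sup>2)) (at p)"
proof -
  have nz: "jy1 p $ 1 \<noteq> 0" using assms by (simp add: regular_jets_def)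
  have "((\<lambda>p. jy2 p $ 0 $ 1 / jy1 p $ 1) has_derivative (\<lambda>a. jy2 a $ 0 $ 1 / jy1 p $ 1
    - jy2 p $ 0 $ 1 * jy1 a $ 1 / (jy1 p $ 1)\<^sup>2)) (at p)"
    by (rule has_derivative_jet_coordinates derivative_eq_intros refl nz)+
      (use nz in \<open>auto simp: fun_eq_iff field_simps power2_eq_square\<close>)
  from has_derivative_transform_within_open[OF this open_regular_jets assms ptx_formula[symmetric]]
  show ?thesis .
qed

lemma pt_formula:
  assumes "p \<in> regular_jets"
  shows "pt p = jy1 p $ 1 * jy1 p $ 0 - (jy3 p $ 0 $ 1 $ 1 / jy1 p $ 1
    - jy2 p $ 0 $ 1 * jy2 p $ 1 $ 1 / (jy1 p $ 1)\<^sup>2)"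
  unfolding pt_def partial_L_t_formula[OF assms] Dtot_def
    frechet_derivative_at[OF ptx_has_derivative[OF assms], symmetric]
  by simp

lemma smooth_on_momenta [smooth_intros]:
  "smooth_on regular_jets L" "smooth_on regular_jets px"
  "smooth_on regular_jets pt" "smooth_on regular_jets ptx"
proof -
  have nz: "jy1 p $ 1 \<noteq> 0" if "p \<in> regular_jets" for p
    using that by (simp add: regular_jets_def)
  note o = open_regular_jets
  have "smooth_on regular_jets (\<lambda>p. 1/2 * (jy1 p $ 1 * (jy1 p $ 0)\<^sup>2 + 1 / jy1 p $ 1 * (jy2 p $ 0 $ 1)\<^sup>2))"
    by (intro smooth_intros o nz)
  then show "smooth_on regular_jets L"
    by (simp add: L_def[abs_def] CH_density_def inverse_eq_divide)
  show "smooth_on regular_jets px"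
    by (rule smooth_on_cong[OF o px_formula[symmetric]], assumption) (intro smooth_intros o; simp add: nz)
  show "smooth_on regular_jets pt"
    by (rule smooth_on_cong[OF o pt_formula[symmetric]], assumption) (intro smooth_intros o; simp add: nz)
  show "smooth_on regular_jets ptx"
    by (rule smooth_on_cong[OF o ptx_formula[symmetric]], assumption) (intro smooth_intros o; simp add: nz)
qed

text \<open>
  The coefficient of \<open>dx \<and> dt\<close> in \<open>Theta\<close>, which on regular jets is the pull-back of the
  Hamiltonian under \<open>FL\<close>.
\<close>

definition energy :: "J3 \<Rightarrow> real" where
  "energy p = L p - px p * jy1 p $ 1 - pt p * jy1 p $ 0 - ptx p * jy2 p $ 0 $ 1"

lemma smooth_on_energy [smooth_intros]: "smooth_on regular_jets energy"
  unfolding energy_def[abs_def] by (intro smooth_intros open_regular_jets)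

text \<open>
  The exterior product of two constant linear forms, evaluated on a pair of vectors.
\<close>

definition minor :: "('a \<Rightarrow> real) \<Rightarrow> ('a \<Rightarrow> real) \<Rightarrow> 'a \<Rightarrow> 'a \<Rightarrow> real" where
  "minor u v a b = u a * v b - u b * v a"

lemma Theta_formula:
  "Theta p a b = px p * minor jy (\<lambda>a. jb a $ 0) a b - pt p * minor jy (\<lambda>a. jb a $ 1) a b
    + ptx p * minor (\<lambda>a. jy1 a $ 0) (\<lambda>a. jb a $ 0) a b
    + energy p * minor (\<lambda>a. jb a $ 1) (\<lambda>a. jb a $ 0) a b"
proof -
  have d: "d0 jy p = jy" "d0 (\<lambda>p. jb p $ i) p = (\<lambda>a. jb a $ i)" "d0 (\<lambda>p. jy1 p $ i) p = (\<lambda>a. jy1 a $ i)" for i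
    unfolding d0_def by (simp_all add: fun_eq_iff frechet_derivative_at[OF has_derivative_jet_coordinates(1), symmetric]
        frechet_derivative_at[OF has_derivative_jet_coordinates(2), symmetric]
        frechet_derivative_at[OF has_derivative_jet_coordinates(3), symmetric])
  have e: "partial_y2 0 1 L = ptx" by (simp add: ptx_def fun_eq_iff)
  have "partial_y1 1 L p = px p" "partial_y1 0 L p - Dtot 1 ptx p = pt p"
    by (simp_all add: px_def pt_def)
  moreover have "L p - px p * jy1 p $ 1 - partial_y1 0 L p * jy1 p $ 0 - ptx p * jy2 p $ 0 $ 1
      + Dtot 1 ptx p * jy1 p $ 0 = energy p"
    by (simp add: energy_def pt_def algebra_simps)
  ultimately show ?thesis
    unfolding Theta_def Let_def wedge_def e d minor_def by simp
qed

text \<open>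
  The coordinate forms are constant, so the exterior derivative of \<open>Theta\<close> differentiates only
  the four coefficients.
\<close>

lemma Omega_formula:
  assumes p: "p \<in> regular_jets"
  defines "D \<equiv> \<lambda>f. frechet_derivative f (at p)"
  defines "W \<equiv> \<lambda>f u v a b c. D f a * minor u v b c - D f b * minor u v a c + D f c * minor u v a b"
  shows "Omega p a b c = W px jy (\<lambda>a. jb a $ 0) a b c - W pt jy (\<lambda>a. jb a $ 1) a b c
    + W ptx (\<lambda>a. jy1 a $ 0) (\<lambda>a. jb a $ 0) a b c + W energy (\<lambda>a. jb a $ 1) (\<lambda>a. jb a $ 0) a b c"
proof -
  have "((\<lambda>q. Theta q a b) has_derivative (\<lambda>c. D px c * minor jy (\<lambda>a. jb a $ 0) a b
      - D pt c * minor jy (\<lambda>a. jb a $ 1) a b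
      + D ptx c * minor (\<lambda>a. jy1 a $ 0) (\<lambda>a. jb a $ 0) a b
      + D energy c * minor (\<lambda>a. jb a $ 1) (\<lambda>a. jb a $ 0) a b)) (at p)" for a b
    unfolding Theta_formula D_def
    by (intro has_derivative_add has_derivative_diff has_derivative_mult_left
        smooth_on_has_derivative[OF smooth_on_momenta(2) p] smooth_on_has_derivative[OF smooth_on_momenta(3) p] smooth_on_has_derivative[OF smooth_on_momenta(4) p] smooth_on_has_derivative[OF smooth_on_energy p])
  note T = fun_cong[OF frechet_derivative_at[OF this], symmetric]
  show ?thesis
    unfolding Omega_def d2_def T W_def by (simp add: algebra_simps)
qed

lemma exhaust_6:
  fixes i :: 6
  shows "i = 1 \<or> i = 2 \<or> i = 3 \<or> i = 4 \<or> i = 5 \<or> i = 6"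
proof (induct i)
  case (of_int z)
  then have "z = 0 \<or> z = 1 \<or> z = 2 \<or> z = 3 \<or> z = 4 \<or> z = 5" by fastforce
  then show ?case by auto
qed

lemma UNIV_6: "(UNIV :: 6 set) = {1, 2, 3, 4, 5, 6}"
  using exhaust_6 by auto

lemma vector_6 [simp]:
  "(vector [a, b, c, d, e, f] :: ('a::zero)^6) $ 1 = a"
  "(vector [a, b, c, d, e, f] :: ('a::zero)^6) $ 2 = b"
  "(vector [a, b, c, d, e, f] :: ('a::zero)^6) $ 3 = c"
  "(vector [a, b, c, d, e, f] :: ('a::zero)^6) $ 4 = d"
  "(vector [a, b, c, d, e, f] :: ('a::zero)^6) $ 5 = e"
  "(vector [a, b, c, d, e, f] :: ('a::zero)^6) $ 6 = f"
  unfolding vector_def by simp_all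

lemma vec6_eq_iff:
  fixes u v :: "'a^6"
  shows "u = v \<longleftrightarrow> u $ 1 = v $ 1 \<and> u $ 2 = v $ 2 \<and> u $ 3 = v $ 3 \<and> u $ 4 = v $ 4 \<and> u $ 5 = v $ 5 \<and> u $ 6 = v $ 6"
proof
  assume *: "u $ 1 = v $ 1 \<and> u $ 2 = v $ 2 \<and> u $ 3 = v $ 3 \<and> u $ 4 = v $ 4 \<and> u $ 5 = v $ 5 \<and> u $ 6 = v $ 6"
  have "u $ i = v $ i" for i
    using exhaust_6[of i] * by (elim disjE) simp_all
  then show "u = v" by (simp add: vec_eq_iff)
qed simp

lemma sum_6: "(\<Sum>i\<in>(UNIV::6 set). g i) = g 1 + g 2 + g 3 + g 4 + g 5 + g 6"
  unfolding UNIV_6 by (simp add: add.assoc)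

lemma omega_formula:
  "omega 1 p u v = u $ 4 * v $ 1 + u $ 6 * v $ 3 - u $ 1 * v $ 4 - u $ 3 * v $ 6"
  "omega 0 p u v = u $ 5 * v $ 1 - u $ 1 * v $ 5"
  by (simp_all add: omega_def B_def matrix_vector_mult_def inner_vec_def sum_6)

lemma multisymplectic_structure_omega: "multisymplectic_structure omega"
  unfolding multisymplectic_structure_def presymplectic_form_def
proof (intro allI conjI)
  fix \<nu> :: 2 and p a b c :: "real^6"
  show "bounded_bilinear (omega \<nu> p)"
    unfolding omega_def[abs_def]
    by (rule bounded_bilinear.comp1[OF bounded_bilinear_inner matrix_vector_mul_bounded_linear])
  show "omega \<nu> p a b = - omega \<nu> p b a"
    using index2_exhaust[of \<nu>] by (auto simp: omega_formula)
  have c: "omega \<nu> = (\<lambda>p. omega \<nu> 0)"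
    by (simp add: fun_eq_iff omega_def)
  show "smooth (\<lambda>p. omega \<nu> p a b)"
    by (subst c) (simp add: smooth_iff_smooth_on smooth_on_const)
  show "d2 (omega \<nu>) p a b c = 0"
    by (subst c) (simp add: d2_def)
qed

lemma FL_nth:
  "FL p $ 1 = jy p" "FL p $ 2 = jy1 p $ 1" "FL p $ 3 = jy1 p $ 0"
  "FL p $ 4 = px p" "FL p $ 5 = pt p" "FL p $ 6 = ptx p"
  by (simp_all add: FL_def)

lemma FL_decomp: "FL p = jy p *\<^sub>R axis 1 1 + (jy1 p $ 1) *\<^sub>R axis 2 1 + (jy1 p $ 0) *\<^sub>R axis 3 1
    + px p *\<^sub>R axis 4 1 + pt p *\<^sub>R axis 5 1 + ptx p *\<^sub>R axis 6 1"
  unfolding vec6_eq_iff by (simp add: FL_nth axis_def)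

lemma smooth_on_FL [smooth_intros]: "smooth_on regular_jets FL"
  unfolding FL_decomp[abs_def] by (intro smooth_intros open_regular_jets)

lemma TFL_nth:
  assumes p: "p \<in> regular_jets"
  shows "TFL w p $ 1 = jy (w p)" "TFL w p $ 2 = jy1 (w p) $ 1" "TFL w p $ 3 = jy1 (w p) $ 0"
    "TFL w p $ 4 = frechet_derivative px (at p) (w p)"
    "TFL w p $ 5 = frechet_derivative pt (at p) (w p)"
    "TFL w p $ 6 = frechet_derivative ptx (at p) (w p)"
proof -
  have "((\<lambda>p. FL p $ i) has_derivative (\<lambda>a. frechet_derivative FL (at p) a $ i)) (at p)" for i
    by (rule bounded_linear.has_derivative[OF bounded_linear_vec_nth smooth_on_has_derivative[OF smooth_on_FL p]])
  from fun_cong[OF frechet_derivative_at[OF this]]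
  have *: "TFL w p $ i = frechet_derivative (\<lambda>p. FL p $ i) (at p) (w p)" for i
    by (simp add: TFL_def)
  show "TFL w p $ 1 = jy (w p)" "TFL w p $ 2 = jy1 (w p) $ 1" "TFL w p $ 3 = jy1 (w p) $ 0"
    "TFL w p $ 4 = frechet_derivative px (at p) (w p)"
    "TFL w p $ 5 = frechet_derivative pt (at p) (w p)"
    "TFL w p $ 6 = frechet_derivative ptx (at p) (w p)"
    unfolding * FL_nth by (simp_all add: frechet_derivative_at[OF has_derivative_jet_coordinates(1), symmetric]
        frechet_derivative_at[OF has_derivative_jet_coordinates(3), symmetric])
qed

text \<open>
  The convention \<open>inverse 0 = 0\<close> makes the polynomial expression valid also at \<open>Z $ 2 = 0\<close>,
  hence \<open>H\<close> is smooth on the whole phase space.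
\<close>

lemma H_formula: "H Z = 1/2 * (Z $ 2 * (Z $ 3)\<^sup>2 - Z $ 2 * (Z $ 6)\<^sup>2) - Z $ 4 * Z $ 2 - Z $ 5 * Z $ 3"
  by (cases "Z $ 2 = 0") (simp_all add: H_def CH_density_def Let_def field_simps power2_eq_square)

lemma H_FL:
  assumes "p \<in> regular_jets"
  shows "H (FL p) = L p - px p * jy1 p $ 1 - pt p * jy1 p $ 0 - ptx p * jy2 p $ 0 $ 1"
proof -
  have "jy1 p $ 1 \<noteq> 0" using assms by (simp add: regular_jets_def)
  then show ?thesis
    by (simp add: H_formula FL_nth L_def CH_density_def ptx_formula[OF assms] field_simps power2_eq_square)
qed

text \<open>
  Every minor that pairs a base coordinate with vertical vectors alone vanishes, so the energy
  term drops out and each momentum stays paired with its conjugate field and one of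
  \<open>dx\<close>, \<open>dt\<close>.
\<close>

lemma Omega_vertical_vertical:
  assumes p: "p \<in> regular_jets" and v: "jb (v p) = 0" and w: "jb (w p) = 0"
  shows "Omega p (w p) (v p) c = omega 0 (FL p) (TFL v p) (TFL w p) * jb c $ 1
    - omega 1 (FL p) (TFL v p) (TFL w p) * jb c $ 0"
  unfolding Omega_formula[OF p] omega_formula TFL_nth[OF p] minor_def v w
  by (simp add: algebra_simps)

section \<open>Prolongation of vertical variations\<close>

lemma smooth_on_jet3 [smooth_intros]: "smooth_on UNIV s \<Longrightarrow> smooth_on UNIV (jet3 s)"
  unfolding jet3_def[abs_def] by (intro smooth_intros open_UNIV)

lemma jet3_nth:
  "jb (jet3 s z) = z" "jy (jet3 s z) = s z" "jy1 (jet3 s z) $ \<mu> = pd \<mu> s z"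
  "jy2 (jet3 s z) $ \<mu> $ \<nu> = pd \<nu> (pd \<mu> s) z"
  "jy3 (jet3 s z) $ \<mu> $ \<nu> $ \<kappa> = pd \<kappa> (pd \<nu> (pd \<mu> s)) z"
  by (simp_all add: jet3_def)

lemma jet3_regular: "configuration k \<eta> \<Longrightarrow> jet3 \<eta> z \<in> regular_jets"
  by (simp add: configuration_def regular_jets_def jet3_nth)

lemma configuration_smooth: "configuration k \<eta> \<Longrightarrow> smooth_on UNIV \<eta>"
  by (simp add: configuration_def bundle_section_def smooth_iff_smooth_on)

lemma jb_jet3_derivative:
  assumes "smooth_on UNIV s"
  shows "jb (frechet_derivative (jet3 s) (at z) a) = a"
proof -
  have "(jet3 s has_derivative frechet_derivative (jet3 s) (at z)) (at z)"
    by (rule smooth_on_has_derivative[OF smooth_on_jet3[OF assms] UNIV_I])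
  from bounded_linear.has_derivative[OF bounded_linear_jets(1) this]
  have "((\<lambda>z. z) has_derivative (\<lambda>a. jb (frechet_derivative (jet3 s) (at z) a))) (at z)"
    by (simp only: jet3_nth)
  from has_derivative_unique[OF this has_derivative_ident] show ?thesis by metis
qed

lemma pd_slice:
  fixes G :: "real \<times> (real^2) \<Rightarrow> real"
  assumes "smooth_on UNIV G"
  shows "pd \<mu> (\<lambda>z. G (l, z)) = (\<lambda>z. frechet_derivative G (at (l, z)) (0, axis \<mu> 1))"
proof
  fix z :: "real^2"
  have "((\<lambda>z. (l, z)) has_derivative (\<lambda>a. (0, a))) (at z)"
    by (auto intro!: derivative_eq_intros)
  from pd_eqI[OF has_derivative_compose[OF this smooth_on_has_derivative[OF assms UNIV_I]]]
  show "pd \<mu> (\<lambda>z. G (l, z)) z = frechet_derivative G (at (l, z)) (0, axis \<mu> 1)" .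
qed

lemma parameter_derivative:
  fixes G :: "real \<times> (real^2) \<Rightarrow> real"
  assumes "smooth_on UNIV G"
  shows "((\<lambda>l. G (l, z)) has_vector_derivative frechet_derivative G (at (l, z)) (1, 0)) (at l)"
proof -
  have "((\<lambda>l. (l, z)) has_derivative (\<lambda>h. h *\<^sub>R (1, 0))) (at l)"
    by (auto intro!: derivative_eq_intros)
  from has_derivative_compose[OF this smooth_on_has_derivative[OF assms UNIV_I, of "(l, z)"]]
  show ?thesis
    by (simp only: has_vector_derivative_def
        linear_scale[OF linear_frechet_derivative[OF smooth_on_differentiable[OF assms UNIV_I]]])
qed

text \<open>
  Derivatives in the parameter commute with those in the space-time directions. The variation
  field \<open>f\<close> is thus the source of the derivative of every jet coordinate of the family.
\<close>

lemma parameter_derivative_slices: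
  fixes G :: "real \<times> (real^2) \<Rightarrow> real"
  assumes G: "smooth_on UNIV G"
    and f: "\<And>z. ((\<lambda>l. G (l, z)) has_vector_derivative f z) (at 0)"
  shows "((\<lambda>l. pd \<mu> (\<lambda>z. G (l, z)) z) has_vector_derivative pd \<mu> f z) (at 0)"
    "((\<lambda>l. pd \<nu> (pd \<mu> (\<lambda>z. G (l, z))) z) has_vector_derivative pd \<nu> (pd \<mu> f) z) (at 0)"
    "((\<lambda>l. pd \<kappa> (pd \<nu> (pd \<mu> (\<lambda>z. G (l, z)))) z) has_vector_derivative pd \<kappa> (pd \<nu> (pd \<mu> f)) z) (at 0)"
proof -
  define P where "P \<mu> F p = frechet_derivative F (at p) (0, axis \<mu> 1)"
    for \<mu> :: 2 and F :: "real \<times> (real^2) \<Rightarrow> real" and p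
  define T where "T F p = frechet_derivative F (at p) (1, 0)"
    for F :: "real \<times> (real^2) \<Rightarrow> real" and p
  have P: "smooth_on UNIV (P \<mu> F)" and T: "smooth_on UNIV (T F)" if "smooth_on UNIV F" for \<mu> F
    unfolding P_def[abs_def] T_def[abs_def] by (rule smooth_on_directional_derivative[OF that])+
  \<comment> \<open>Symmetry of the second derivative on the product of parameter line and plane.\<close>
  have TP: "T (P \<mu> F) = P \<mu> (T F)" if "smooth_on UNIV F" for \<mu> F
    unfolding T_def P_def by (intro ext second_derivative_symmetric[OF that]) auto
  have pdP: "pd \<mu> (\<lambda>z. F (l, z)) = (\<lambda>z. P \<mu> F (l, z))" if "smooth_on UNIV F" for \<mu> F l
    unfolding P_def by (rule pd_slice[OF that])
  have DT: "((\<lambda>l. F (l, z)) has_vector_derivative T F (0, z)) (at 0)" if "smooth_on UNIV F" for F z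
    unfolding T_def by (rule parameter_derivative[OF that])
  have f_T: "f = (\<lambda>z. T G (0, z))"
    using vector_derivative_unique_at[OF f DT[OF G]] by (rule ext)
  note PG = P[OF G] P[OF P[OF G]] P[OF P[OF P[OF G]]] P[OF T[OF G]] P[OF P[OF T[OF G]]]
  show "((\<lambda>l. pd \<mu> (\<lambda>z. G (l, z)) z) has_vector_derivative pd \<mu> f z) (at 0)"
    using DT[OF PG(1)] by (simp only: f_T pdP[OF G] pdP[OF T[OF G]] TP[OF G])
  show "((\<lambda>l. pd \<nu> (pd \<mu> (\<lambda>z. G (l, z))) z) has_vector_derivative pd \<nu> (pd \<mu> f) z) (at 0)"
    using DT[OF PG(2)]
    by (simp only: f_T pdP[OF G] pdP[OF PG(1)] pdP[OF T[OF G]] pdP[OF PG(4)] TP[OF G] TP[OF PG(1)])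
  show "((\<lambda>l. pd \<kappa> (pd \<nu> (pd \<mu> (\<lambda>z. G (l, z)))) z) has_vector_derivative pd \<kappa> (pd \<nu> (pd \<mu> f)) z) (at 0)"
    using DT[OF PG(3)]
    by (simp only: f_T pdP[OF G] pdP[OF PG(1)] pdP[OF PG(2)] pdP[OF T[OF G]] pdP[OF PG(4)] pdP[OF PG(5)]
        TP[OF G] TP[OF PG(1)] TP[OF PG(2)])
qed

text \<open>
  The base component of the generating field depends only on the base point, because the flow
  maps fibres to fibres. It vanishes on the graph of \<open>\<eta>\<close>, which meets every fibre, hence
  everywhere, and the induced flow on the base is constant.
\<close>

lemma flow_vertical:
  assumes flow: "automorphism_flow k v \<psi>" and v: "\<And>z. v (z, \<eta> z) = V z" and V: "vertical V"
  shows "base_map (\<psi> l) = (\<lambda>z. z)"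
proof -
  have fib: "fst (\<psi> l q) = base_map (\<psi> l) (fst q)" for l q
    using flow unfolding automorphism_flow_def bundle_automorphism_def by blast
  have D: "((\<lambda>l. fst (\<psi> l q)) has_vector_derivative fst (v (\<psi> l q))) (at l)" for l q
    using flow bounded_linear.has_vector_derivative[OF bounded_linear_fst]
    unfolding automorphism_flow_def by blast
  have id: "\<psi> 0 q = q" for q
    using flow by (simp add: automorphism_flow_def)
  have fst0: "fst (v q) = 0" for q
  proof -
    have "fst (v q) = fst (v (fst q, \<eta> (fst q)))"
      using vector_derivative_unique_at[OF D[of q 0] D[of "(fst q, \<eta> (fst q))" 0, unfolded fib fst_conv, folded fib]]
      by (simp add: id)
    then show ?thesis using V v by (simp add: vertical_def)
  qed
  have "fst (\<psi> l q) = fst (\<psi> 0 q)" for q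
  proof -
    have "\<exists>c. \<forall>l\<in>UNIV. fst (\<psi> l q) = c"
      by (rule has_derivative_zero_constant[OF convex_UNIV])
        (use D[of q] fst0 in \<open>simp add: has_vector_derivative_def\<close>)
    then show ?thesis by auto
  qed
  then have "base_map (\<psi> l) z = z" for z
    by (simp add: base_map_def id)
  then show ?thesis by (rule ext)
qed

text \<open>
  Since the flow covers the identity, pushing the section forward only moves its values:
  \<open>G (l, z)\<close> is the moved section, and the prolonged field is the parameter derivative of its jet.
  In particular the values of \<open>j\<^sup>3(V)\<close> on the jet of \<open>\<eta>\<close> depend on \<open>V\<close> alone, whatever
  extension was used to define it.
\<close>

lemma third_prolongation_vertical:
  assumes \<eta>: "bundle_section k \<eta>" and w: "third_prolongation k \<eta> V w" and V: "vertical V"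
  shows "w (jet3 \<eta> z) = (0, snd (jet3 (\<lambda>z. snd (V z)) z))"
proof -
  from w have "\<exists>v \<psi>. (\<forall>z. v (z, \<eta> z) = V z) \<and> automorphism_flow k v \<psi> \<and>
        (\<forall>s z. bundle_section k s \<longrightarrow>
           ((\<lambda>l. jet3 (push_section (\<psi> l) s) (base_map (\<psi> l) z))
              has_vector_derivative w (jet3 s z)) (at 0))"
    by (simp only: third_prolongation_def)
  then obtain v \<psi> where v: "\<And>z. v (z, \<eta> z) = V z" and flow: "automorphism_flow k v \<psi>"
    and D: "\<And>s z. bundle_section k s \<Longrightarrow>
      ((\<lambda>l. jet3 (push_section (\<psi> l) s) (base_map (\<psi> l) z)) has_vector_derivative w (jet3 s z)) (at 0)"
    by blast
  have base: "base_map (\<psi> l) = (\<lambda>z. z)" for l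
    by (rule flow_vertical[OF flow v V])
  define G where "G = (\<lambda>(l, z). snd (\<psi> l (z, \<eta> z)))"
  have push: "push_section (\<psi> l) \<eta> = (\<lambda>z. G (l, z))" for l
    by (simp add: push_section_def base G_def fun_eq_iff inv_id[unfolded id_def])
  have \<psi>: "smooth_on UNIV (\<lambda>(l, q). \<psi> l q)" and \<eta>': "smooth_on UNIV \<eta>"
    using flow \<eta> by (simp_all only: automorphism_flow_def bundle_section_def smooth_iff_smooth_on)
  have "smooth_on UNIV (\<lambda>p :: real \<times> (real^2). (\<lambda>(l, q). \<psi> l q) (fst p, (snd p, \<eta> (snd p))))"
    by (rule smooth_on_compose[OF \<psi>])
      (intro smooth_intros smooth_on_compose[OF \<eta>'] open_UNIV subset_UNIV)+
  then have G: "smooth_on UNIV G"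
    using smooth_on_snd[OF open_UNIV] by (simp add: G_def case_prod_unfold)
  let ?f = "\<lambda>z. snd (V z)"
  have f: "((\<lambda>l. G (l, z)) has_vector_derivative ?f z) (at 0)" for z
  proof -
    have "((\<lambda>l. \<psi> l (z, \<eta> z)) has_vector_derivative v (\<psi> 0 (z, \<eta> z))) (at 0)"
      using flow unfolding automorphism_flow_def by blast
    moreover have "\<psi> 0 (z, \<eta> z) = (z, \<eta> z)"
      using flow by (simp add: automorphism_flow_def)
    ultimately have "((\<lambda>l. \<psi> l (z, \<eta> z)) has_vector_derivative V z) (at 0)"
      by (simp only: v)
    from bounded_linear.has_vector_derivative[OF bounded_linear_snd this] show ?thesis
      by (simp only: G_def case_prod_conv)
  qed
  have jet: "((\<lambda>l. jet3 (\<lambda>z. G (l, z)) z) has_vector_derivative w (jet3 \<eta> z)) (at 0)"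
    using D[OF \<eta>] by (simp add: push base)
  have comp: "((\<lambda>l. h (jet3 (\<lambda>z. G (l, z)) z)) has_vector_derivative h (w (jet3 \<eta> z))) (at 0)"
    if "bounded_linear h" for h :: "J3 \<Rightarrow> 'b::real_normed_vector"
    by (rule bounded_linear.has_vector_derivative[OF that jet])
  note nth = bounded_linear_compose[OF bounded_linear_vec_nth]
  have 0: "jb (w (jet3 \<eta> z)) = 0"
    using vector_derivative_unique_at[OF comp[OF bounded_linear_jets(1), unfolded jet3_nth] has_vector_derivative_const] .
  have 1: "jy (w (jet3 \<eta> z)) = ?f z"
    using vector_derivative_unique_at[OF comp[OF bounded_linear_jets(2), unfolded jet3_nth] f] .
  have 2: "jy1 (w (jet3 \<eta> z)) $ \<mu> = pd \<mu> ?f z" for \<mu>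
    using vector_derivative_unique_at[OF comp[OF nth[OF bounded_linear_jets(3)], unfolded jet3_nth]
        parameter_derivative_slices(1)[OF G f]] .
  have 3: "jy2 (w (jet3 \<eta> z)) $ \<mu> $ \<nu> = pd \<nu> (pd \<mu> ?f) z" for \<mu> \<nu>
    using vector_derivative_unique_at[OF comp[OF nth[OF nth[OF bounded_linear_jets(4)]], unfolded jet3_nth]
        parameter_derivative_slices(2)[OF G f]] .
  have 4: "jy3 (w (jet3 \<eta> z)) $ \<mu> $ \<nu> $ \<kappa> = pd \<kappa> (pd \<nu> (pd \<mu> ?f)) z" for \<mu> \<nu> \<kappa>
    using vector_derivative_unique_at[OF comp[OF nth[OF nth[OF nth[OF bounded_linear_jets(5)]]], unfolded jet3_nth]
        parameter_derivative_slices(3)[OF G f]] .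
  show ?thesis
    using 0 1 2 3 4
    by (simp add: prod_eq_iff vec_eq_iff jet3_def jb_def jy_def jy1_def jy2_def jy3_def)
qed

section \<open>First variations and the conservation law\<close>

text \<open>
  The coordinate field \<open>\<partial>/\<partial>\<eta>\<close>; contracting \<open>Omega\<close> with it gives the form whose pull-back
  is the Euler--Lagrange expression.
\<close>

definition fibre_vector :: J3 where "fibre_vector = (0, 1, 0, 0, 0)"

lemma jet_coordinates_fibre_shift:
  "jb (q + s *\<^sub>R fibre_vector) = jb q" "jy1 (q + s *\<^sub>R fibre_vector) = jy1 q"
  "jy2 (q + s *\<^sub>R fibre_vector) = jy2 q" "jy3 (q + s *\<^sub>R fibre_vector) = jy3 q"
  by (simp_all add: jb_def jy1_def jy2_def jy3_def fibre_vector_def)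

lemma derivative_zero_if_shift_invariant:
  fixes f :: "'a::real_normed_vector \<Rightarrow> real"
  assumes f: "smooth_on S f" and q: "q \<in> S" and inv: "\<And>s. f (q + s *\<^sub>R e) = f q"
  shows "frechet_derivative f (at q) e = 0"
proof -
  have "((\<lambda>s. f (q + s *\<^sub>R e)) has_real_derivative frechet_derivative f (at q) e) (at 0)"
    using directional_derivative_along_line[OF f, of q 0 e] q by simp
  then show ?thesis
    unfolding inv using DERIV_unique[OF _ DERIV_const] by blast
qed

text \<open>
  None of these functions involves \<open>\<eta>\<close> itself.
\<close>

lemma momenta_fibre_derivative:
  assumes q: "q \<in> regular_jets"
  shows "frechet_derivative px (at q) fibre_vector = 0" "frechet_derivative pt (at q) fibre_vector = 0"
    "frechet_derivative ptx (at q) fibre_vector = 0" "frechet_derivative energy (at q) fibre_vector = 0"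
proof -
  have r: "q + s *\<^sub>R fibre_vector \<in> regular_jets" for s
    using q by (simp add: regular_jets_def jet_coordinates_fibre_shift)
  note m = px_formula[OF q] px_formula[OF r] pt_formula[OF q] pt_formula[OF r] ptx_formula[OF q] ptx_formula[OF r]
  show "frechet_derivative px (at q) fibre_vector = 0"
    by (rule derivative_zero_if_shift_invariant[OF smooth_on_momenta(2) q]) (simp only: m jet_coordinates_fibre_shift)
  show "frechet_derivative pt (at q) fibre_vector = 0"
    by (rule derivative_zero_if_shift_invariant[OF smooth_on_momenta(3) q]) (simp only: m jet_coordinates_fibre_shift)
  show "frechet_derivative ptx (at q) fibre_vector = 0"
    by (rule derivative_zero_if_shift_invariant[OF smooth_on_momenta(4) q]) (simp only: m jet_coordinates_fibre_shift)
  show "frechet_derivative energy (at q) fibre_vector = 0"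
    by (rule derivative_zero_if_shift_invariant[OF smooth_on_energy q])
      (simp only: m energy_def L_def jet_coordinates_fibre_shift)
qed

lemma Omega_fibre_vector:
  assumes q: "q \<in> regular_jets"
  shows "Omega q fibre_vector a b =
    - (frechet_derivative px (at q) a * jb b $ 0 - frechet_derivative px (at q) b * jb a $ 0)
    + (frechet_derivative pt (at q) a * jb b $ 1 - frechet_derivative pt (at q) b * jb a $ 1)"
  unfolding Omega_formula[OF q] momenta_fibre_derivative[OF q] minor_def
  by (simp add: fibre_vector_def)

text \<open>
  The pull-back of the contraction of \<open>\<Omega>\<close> with \<open>\<partial>/\<partial>\<eta>\<close> is \<open>- (\<partial>\<^sub>xp\<^sup>x + \<partial>\<^sub>tp\<^sup>t) dx\<and>dt\<close>, whose vanishing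
  is the Euler--Lagrange equation, and Lie derivation linearises it. The Lie derivative consists of a term that differentiates the coefficients and of terms
  that differentiate \<open>w\<close>; together they are the derivative of \<open>dp(w)\<close> along the jet, by symmetry
  of the second derivative of the momenta.
\<close>

lemma lie_derivative_euler_lagrange:
  assumes \<eta>: "smooth_on UNIV \<eta>" and reg: "\<And>z. jet3 \<eta> z \<in> regular_jets"
    and w: "smooth_on UNIV w" and w0: "\<And>z. jb (w (jet3 \<eta> z)) = 0"
  shows "pullback2 (jet3 \<eta>) (lie2 w (interior_prod (\<lambda>_. fibre_vector) Omega)) z (axis 1 1) (axis 0 1) =
    - (pd 1 (\<lambda>z. frechet_derivative px (at (jet3 \<eta> z)) (w (jet3 \<eta> z))) z
     + pd 0 (\<lambda>z. frechet_derivative pt (at (jet3 \<eta> z)) (w (jet3 \<eta> z))) z)"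
proof -
  let ?J = "jet3 \<eta>"
  define p where "p = ?J z"
  define DJ where "DJ = frechet_derivative ?J (at z)"
  define a where "a = DJ (axis 1 1)"
  define b where "b = DJ (axis 0 1)"
  define Dw where "Dw = frechet_derivative w (at p)"
  note S = open_regular_jets
  have p: "p \<in> regular_jets" using reg by (simp add: p_def)
  have DJ: "(?J has_derivative DJ) (at z)"
    unfolding DJ_def by (rule smooth_on_has_derivative[OF smooth_on_jet3[OF \<eta>] UNIV_I])
  have Dw: "(w has_derivative Dw) (at (?J z))"
    unfolding Dw_def p_def by (rule smooth_on_has_derivative[OF w UNIV_I])
  note DwJ = has_derivative_compose[OF DJ Dw]
  have jb_a: "jb a = axis 1 1" and jb_b: "jb b = axis 0 1"
    unfolding a_def b_def DJ_def by (rule jb_jet3_derivative[OF \<eta>])+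
  have jb_Dw: "jb (Dw (DJ c)) = 0" for c
  proof -
    have "((\<lambda>z. 0) has_derivative (\<lambda>c. jb (Dw (DJ c)))) (at z)"
      using bounded_linear.has_derivative[OF bounded_linear_jets(1) DwJ] by (simp only: w0)
    from fun_cong[OF has_derivative_unique[OF this has_derivative_const]] show ?thesis .
  qed
  have along: "pd \<mu> (\<lambda>z. frechet_derivative f (at (?J z)) (w (?J z))) z =
      frechet_derivative (\<lambda>q. frechet_derivative f (at q) (DJ (axis \<mu> 1))) (at p) (w p)
      + frechet_derivative f (at p) (Dw (DJ (axis \<mu> 1)))"
    if f: "smooth_on regular_jets f" for f :: "J3 \<Rightarrow> real" and \<mu>
    unfolding pd_eqI[OF has_derivative_derivative_along[OF S f reg DJ DwJ]]
      second_derivative_symmetric[OF f S reg, of "w (?J z)"] p_def ..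
  have "frechet_derivative (\<lambda>q. Omega q fibre_vector a b) (at p) (w p) =
      - frechet_derivative (\<lambda>q. frechet_derivative px (at q) a) (at p) (w p)
      - frechet_derivative (\<lambda>q. frechet_derivative pt (at q) b) (at p) (w p)"
  proof -
    have "((\<lambda>q. - frechet_derivative px (at q) a - frechet_derivative pt (at q) b) has_derivative
      (\<lambda>v. - frechet_derivative (\<lambda>q. frechet_derivative px (at q) a) (at p) v
      - frechet_derivative (\<lambda>q. frechet_derivative pt (at q) b) (at p) v)) (at p)"
      by (intro has_derivative_diff has_derivative_minus
          smooth_on_has_derivative[OF smooth_on_directional_derivative[OF smooth_on_momenta(2)] p]
          smooth_on_has_derivative[OF smooth_on_directional_derivative[OF smooth_on_momenta(3)] p])
    then have "((\<lambda>q. Omega q fibre_vector a b) has_derivative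
      (\<lambda>v. - frechet_derivative (\<lambda>q. frechet_derivative px (at q) a) (at p) v
      - frechet_derivative (\<lambda>q. frechet_derivative pt (at q) b) (at p) v)) (at p)"
      by (rule has_derivative_transform_within_open[OF _ S p])
        (simp add: Omega_fibre_vector jb_a jb_b axis_def)
    from fun_cong[OF frechet_derivative_at[OF this]] show ?thesis by simp
  qed
  moreover have "Omega p fibre_vector (Dw a) b = - frechet_derivative px (at p) (Dw a)"
    unfolding Omega_fibre_vector[OF p] a_def jb_Dw jb_b by (simp add: axis_def)
  moreover have "Omega p fibre_vector a (Dw b) = - frechet_derivative pt (at p) (Dw b)"
    unfolding Omega_fibre_vector[OF p] b_def jb_Dw jb_a by (simp add: axis_def)
  ultimately have "lie2 w (interior_prod (\<lambda>_. fibre_vector) Omega) p a b =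
    - (pd 1 (\<lambda>z. frechet_derivative px (at (?J z)) (w (?J z))) z
     + pd 0 (\<lambda>z. frechet_derivative pt (at (?J z)) (w (?J z))) z)"
    unfolding along[OF smooth_on_momenta(2)] along[OF smooth_on_momenta(3)]
      lie2_def interior_prod_def a_def[symmetric] b_def[symmetric] Dw_def[symmetric]
    by simp
  then show ?thesis
    unfolding pullback2_def p_def a_def b_def DJ_def .
qed

lemma px_has_derivative:
  assumes p: "p \<in> regular_jets"
  shows "(px has_derivative (\<lambda>a. jy1 p $ 0 * jy1 a $ 0 - jy2 p $ 0 $ 1 / jy1 p $ 1 *
    (jy2 a $ 0 $ 1 / jy1 p $ 1 - jy2 p $ 0 $ 1 * jy1 a $ 1 / (jy1 p $ 1)\<^sup>2))) (at p)"
proof -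
  have nz: "jy1 p $ 1 \<noteq> 0" using p by (simp add: regular_jets_def)
  have "((\<lambda>p. 1/2 * ((jy1 p $ 0)\<^sup>2 - (jy2 p $ 0 $ 1 / jy1 p $ 1)\<^sup>2)) has_derivative
    (\<lambda>a. jy1 p $ 0 * jy1 a $ 0 - jy2 p $ 0 $ 1 / jy1 p $ 1 *
    (jy2 a $ 0 $ 1 / jy1 p $ 1 - jy2 p $ 0 $ 1 * jy1 a $ 1 / (jy1 p $ 1)\<^sup>2))) (at p)"
    by (rule has_derivative_jet_coordinates derivative_eq_intros refl nz)+
      (use nz in \<open>auto simp: fun_eq_iff field_simps power2_eq_square\<close>)
  from has_derivative_transform_within_open[OF this open_regular_jets p px_formula[symmetric]]
  show ?thesis .
qed

lemma pt_has_derivative: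
  assumes p: "p \<in> regular_jets"
  shows "(pt has_derivative (\<lambda>a. jy1 a $ 1 * jy1 p $ 0 + jy1 p $ 1 * jy1 a $ 0
    - (jy3 a $ 0 $ 1 $ 1 / jy1 p $ 1 - jy3 p $ 0 $ 1 $ 1 * jy1 a $ 1 / (jy1 p $ 1)\<^sup>2
      - (jy2 a $ 0 $ 1 * jy2 p $ 1 $ 1 + jy2 p $ 0 $ 1 * jy2 a $ 1 $ 1) / (jy1 p $ 1)\<^sup>2
      + 2 * jy2 p $ 0 $ 1 * jy2 p $ 1 $ 1 * jy1 a $ 1 / (jy1 p $ 1)^3))) (at p)"
proof -
  have nz: "jy1 p $ 1 \<noteq> 0" using p by (simp add: regular_jets_def)
  have nz2: "(jy1 p $ 1)\<^sup>2 \<noteq> 0" using nz by simp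
  have "((\<lambda>p. jy1 p $ 1 * jy1 p $ 0 - (jy3 p $ 0 $ 1 $ 1 / jy1 p $ 1
    - jy2 p $ 0 $ 1 * jy2 p $ 1 $ 1 / (jy1 p $ 1)\<^sup>2)) has_derivative
    (\<lambda>a. jy1 a $ 1 * jy1 p $ 0 + jy1 p $ 1 * jy1 a $ 0
    - (jy3 a $ 0 $ 1 $ 1 / jy1 p $ 1 - jy3 p $ 0 $ 1 $ 1 * jy1 a $ 1 / (jy1 p $ 1)\<^sup>2
      - (jy2 a $ 0 $ 1 * jy2 p $ 1 $ 1 + jy2 p $ 0 $ 1 * jy2 a $ 1 $ 1) / (jy1 p $ 1)\<^sup>2
      + 2 * jy2 p $ 0 $ 1 * jy2 p $ 1 $ 1 * jy1 a $ 1 / (jy1 p $ 1)^3))) (at p)"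
    by (rule has_derivative_jet_coordinates derivative_eq_intros refl nz nz2)+
      (use nz in \<open>auto simp: fun_eq_iff field_simps power2_eq_square power3_eq_cube\<close>)
  from has_derivative_transform_within_open[OF this open_regular_jets p pt_formula[symmetric]]
  show ?thesis .
qed

text \<open>
  The derivatives of \<open>\<delta>p\<^sup>x\<close> and \<open>\<delta>p\<^sup>t\<close> cancel by hypothesis. In the rest,
  \<open>\<delta>p\<^sup>t + \<partial>\<^sub>x\<delta>p\<^sup>t\<^sup>x\<close> is the linearisation of \<open>\<partial>L/\<partial>\<eta>\<^sub>t\<close>, so that what remains is the difference of
  the second derivative of \<open>L\<close> on \<open>(f, g)\<close> and on \<open>(g, f)\<close>.
\<close>

lemma conservation_from_linearised_equation:
  fixes \<eta> f g :: "real^2 \<Rightarrow> real"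
  assumes \<eta>: "smooth_on UNIV \<eta>" and reg: "\<And>z. jet3 \<eta> z \<in> regular_jets"
    and f: "smooth_on UNIV f" and g: "smooth_on UNIV g"
  defines "\<delta> \<equiv> \<lambda>p f z. frechet_derivative p (at (jet3 \<eta> z)) (0, snd (jet3 f z))"
  assumes lin_f: "\<And>z. pd 1 (\<delta> px f) z + pd 0 (\<delta> pt f) z = 0"
    and lin_g: "\<And>z. pd 1 (\<delta> px g) z + pd 0 (\<delta> pt g) z = 0"
  shows "pd 1 (\<lambda>z. \<delta> px f z * g z + \<delta> ptx f z * pd 0 g z - f z * \<delta> px g z - pd 0 f z * \<delta> ptx g z) z
    + pd 0 (\<lambda>z. \<delta> pt f z * g z - f z * \<delta> pt g z) z = 0"
proof -
  have nz: "pd 1 \<eta> z \<noteq> 0" for z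
    using reg[of z] by (simp add: regular_jets_def jet3_nth)
  have jets: "jy (0, snd (jet3 h z)) = h z" "jy1 (0, snd (jet3 h z)) $ \<mu> = pd \<mu> h z"
    "jy2 (0, snd (jet3 h z)) $ \<mu> $ \<nu> = pd \<nu> (pd \<mu> h) z"
    "jy3 (0, snd (jet3 h z)) $ \<mu> $ \<nu> $ \<kappa> = pd \<kappa> (pd \<nu> (pd \<mu> h)) z" for h z \<mu> \<nu> \<kappa>
    by (simp_all add: jet3_def jy_def jy1_def jy2_def jy3_def)
  have \<delta>px: "\<delta> px h z = pd 0 \<eta> z * pd 0 h z - pd 1 (pd 0 \<eta>) z / pd 1 \<eta> z *
      (pd 1 (pd 0 h) z / pd 1 \<eta> z - pd 1 (pd 0 \<eta>) z * pd 1 h z / (pd 1 \<eta> z)\<^sup>2)" for h z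
    unfolding \<delta>_def fun_cong[OF frechet_derivative_at[OF px_has_derivative[OF reg]], symmetric] jets jet3_nth ..
  have \<delta>ptx: "\<delta> ptx h = (\<lambda>z. pd 1 (pd 0 h) z / pd 1 \<eta> z - pd 1 (pd 0 \<eta>) z * pd 1 h z / (pd 1 \<eta> z)\<^sup>2)" for h
    unfolding \<delta>_def fun_cong[OF frechet_derivative_at[OF ptx_has_derivative[OF reg]], symmetric] jets jet3_nth ..
  have sm: "smooth_on UNIV (\<delta> p h)" if "smooth_on regular_jets p" "smooth_on UNIV h" for p h
    unfolding \<delta>_def
    by (rule smooth_on_derivative_along[OF open_UNIV that(1) smooth_on_jet3[OF \<eta>] reg])
      (intro smooth_intros open_UNIV that(2))
  have d: "F differentiable at z" if "smooth_on UNIV F" for F :: "real^2 \<Rightarrow> real" and z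
    by (rule smooth_on_differentiable[OF that UNIV_I])
  have \<delta>pt: "\<delta> pt h z = pd 1 h z * pd 0 \<eta> z + pd 1 \<eta> z * pd 0 h z - pd 1 (\<delta> ptx h) z"
    if h: "smooth_on UNIV h" for h z
  proof -
    have nz2: "(pd 1 \<eta> z)\<^sup>2 \<noteq> 0" using nz by simp
    note dE = d[OF smooth_on_pd[OF \<eta>], of 1 z] and dM = d[OF smooth_on_pd[OF smooth_on_pd[OF \<eta>]], of 1 0 z]
      and dK = d[OF smooth_on_pd[OF h], of 1 z] and dN = d[OF smooth_on_pd[OF smooth_on_pd[OF h]], of 1 0 z]
    note dMK = differentiable_mult[OF dM dK] and dE2 = differentiable_power[OF dE, of 2]
    note dq = differentiable_divide[OF dN dE nz] differentiable_divide[OF dMK dE2 nz2]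
    have e: "pd 1 (\<delta> ptx h) z = pd 1 (pd 1 (pd 0 h)) z / pd 1 \<eta> z - pd 1 (pd 0 h) z * pd 1 (pd 1 \<eta>) z / (pd 1 \<eta> z)\<^sup>2
      - ((pd 1 (pd 0 \<eta>) z * pd 1 (pd 1 h) z + pd 1 (pd 1 (pd 0 \<eta>)) z * pd 1 h z) / (pd 1 \<eta> z)\<^sup>2
         - pd 1 (pd 0 \<eta>) z * pd 1 h z * (2 * pd 1 \<eta> z * pd 1 (pd 1 \<eta>) z) / ((pd 1 \<eta> z)\<^sup>2)\<^sup>2)"
      unfolding \<delta>ptx
      by (simp only: pd_diff[OF dq] pd_divide[OF dN dE nz] pd_divide[OF dMK dE2 nz2] pd_mult[OF dM dK] pd_power2[OF dE])
    show ?thesis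
      unfolding e unfolding \<delta>_def fun_cong[OF frechet_derivative_at[OF pt_has_derivative[OF reg]], symmetric] jets jet3_nth
      using nz[of z] by (simp add: field_simps power2_eq_square power3_eq_cube)
  qed
  note s = sm[OF smooth_on_momenta(2) f] sm[OF smooth_on_momenta(2) g] sm[OF smooth_on_momenta(3) f]
    sm[OF smooth_on_momenta(3) g] sm[OF smooth_on_momenta(4) f] sm[OF smooth_on_momenta(4) g] f g
    smooth_on_pd[OF f] smooth_on_pd[OF g]
  have 1: "pd 1 (\<lambda>z. \<delta> px f z * g z + \<delta> ptx f z * pd 0 g z - f z * \<delta> px g z - pd 0 f z * \<delta> ptx g z) z =
      (\<delta> px f z * pd 1 g z + pd 1 (\<delta> px f) z * g z) + (\<delta> ptx f z * pd 1 (pd 0 g) z + pd 1 (\<delta> ptx f) z * pd 0 g z)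
      - (f z * pd 1 (\<delta> px g) z + pd 1 f z * \<delta> px g z) - (pd 0 f z * pd 1 (\<delta> ptx g) z + pd 1 (pd 0 f) z * \<delta> ptx g z)"
    by (simp add: pd_diff pd_add pd_mult d smooth_intros s)
  have 2: "pd 0 (\<lambda>z. \<delta> pt f z * g z - f z * \<delta> pt g z) z =
      (\<delta> pt f z * pd 0 g z + pd 0 (\<delta> pt f) z * g z) - (f z * pd 0 (\<delta> pt g) z + pd 0 f z * \<delta> pt g z)"
    by (simp add: pd_diff pd_mult d smooth_intros s)
  have lf: "pd 0 (\<delta> pt f) z = - pd 1 (\<delta> px f) z" and lg: "pd 0 (\<delta> pt g) z = - pd 1 (\<delta> px g) z"
    using lin_f[of z] lin_g[of z] by linarith+
  show ?thesis
    unfolding 1 2 unfolding lf lg \<delta>pt[OF f] \<delta>pt[OF g]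
    unfolding \<delta>px fun_cong[OF \<delta>ptx] by (simp add: algebra_simps power2_eq_square)
qed


lemma vertical_component_smooth: "variation V \<Longrightarrow> smooth_on UNIV (\<lambda>z. snd (V z))"
  unfolding variation_def invariant_field_def smooth_iff_smooth_on
  by (intro smooth_on_snd open_UNIV) simp

text \<open>
  The first-variation condition comes with a prolongation of its own, but by
  \<open>third_prolongation_vertical\<close> its values along the jet are those of the jet of \<open>V\<close>.
\<close>

lemma first_variation_linearised_equation:
  assumes \<eta>: "configuration k \<eta>" and V: "first_variation k \<eta> V" "vertical V"
  defines "\<delta> \<equiv> \<lambda>p z. frechet_derivative p (at (jet3 \<eta> z)) (0, snd (jet3 (\<lambda>z. snd (V z)) z))"
  shows "pd 1 (\<delta> px) z + pd 0 (\<delta> pt) z = 0"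
proof -
  obtain w where w: "third_prolongation k \<eta> V w"
    and lie: "\<And>W z a b. invariant_field (deckJ k) W \<Longrightarrow>
      pullback2 (jet3 \<eta>) (lie2 w (interior_prod W Omega)) z a b = 0"
    using V(1) unfolding first_variation_def by blast
  have "bundle_section k \<eta>" using \<eta> by (simp add: configuration_def)
  note w_jet = third_prolongation_vertical[OF this w V(2)]
  have sw: "smooth_on UNIV w"
    using w by (simp add: third_prolongation_def invariant_field_def smooth_iff_smooth_on)
  have inv: "invariant_field (deckJ k) (\<lambda>_. fibre_vector)"
    by (simp add: invariant_field_def smooth_iff_smooth_on smooth_on_const)
  have w0: "jb (w (jet3 \<eta> z)) = 0" for z
    unfolding w_jet by (simp add: jb_def)
  have "- (pd 1 (\<lambda>z. frechet_derivative px (at (jet3 \<eta> z)) (w (jet3 \<eta> z))) z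
     + pd 0 (\<lambda>z. frechet_derivative pt (at (jet3 \<eta> z)) (w (jet3 \<eta> z))) z) = 0"
    unfolding lie_derivative_euler_lagrange[OF configuration_smooth[OF \<eta>] jet3_regular[OF \<eta>] sw w0, symmetric]
    by (rule lie[OF inv])
  then show ?thesis
    unfolding w_jet \<delta>_def by linarith
qed

lemma first_variations_conservation_law:
  assumes \<eta>: "configuration k \<eta>"
    and V: "first_variation k \<eta> V" "vertical V" "third_prolongation k \<eta> V jV"
    and W: "first_variation k \<eta> W" "vertical W" "third_prolongation k \<eta> W jW"
  shows "conservation_law \<eta> jV jW"
proof -
  have \<eta>': "bundle_section k \<eta>" using \<eta> by (simp add: configuration_def)
  have sm: "smooth_on UNIV (\<lambda>z. snd (V z))" "smooth_on UNIV (\<lambda>z. snd (W z))"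
    using V(1) W(1) by (auto simp: first_variation_def intro: vertical_component_smooth)
  have jets: "jy (0, snd (jet3 h z)) = h z" "jy1 (0, snd (jet3 h z)) $ \<mu> = pd \<mu> h z" for h z \<mu>
    by (simp_all add: jet3_def jy_def jy1_def)
  show ?thesis
    unfolding conservation_law_def omega_formula TFL_nth[OF jet3_regular[OF \<eta>]]
      third_prolongation_vertical[OF \<eta>' V(3,2)] third_prolongation_vertical[OF \<eta>' W(3,2)] jets
    by (rule allI, rule conservation_from_linearised_equation[OF configuration_smooth[OF \<eta>] jet3_regular[OF \<eta>] sm
        first_variation_linearised_equation[OF \<eta> V(1,2)] first_variation_linearised_equation[OF \<eta> W(1,2)]])
qed

lemma form_integrand_formula:
  assumes \<eta>: "configuration k \<eta>" and V: "vertical V" "third_prolongation k \<eta> V jV"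
    and W: "vertical W" "third_prolongation k \<eta> W jW"
  shows "form_integrand \<eta> jV jW z a =
    omega 0 (FL (jet3 \<eta> z)) (TFL jV (jet3 \<eta> z)) (TFL jW (jet3 \<eta> z)) * a $ 1
    - omega 1 (FL (jet3 \<eta> z)) (TFL jV (jet3 \<eta> z)) (TFL jW (jet3 \<eta> z)) * a $ 0"
proof -
  have \<eta>': "bundle_section k \<eta>" using \<eta> by (simp add: configuration_def)
  have "jb (jV (jet3 \<eta> z)) = 0" "jb (jW (jet3 \<eta> z)) = 0"
    unfolding third_prolongation_vertical[OF \<eta>' V(2,1)] third_prolongation_vertical[OF \<eta>' W(2,1)]
    by (simp_all add: jb_def)
  from Omega_vertical_vertical[of "jet3 \<eta> z" jV jW, OF jet3_regular[OF \<eta>] this]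
  show ?thesis
    by (simp add: form_integrand_def pullback1_def interior_prod_def
        jb_jet3_derivative[OF configuration_smooth[OF \<eta>]])
qed

lemma omega_along_jets_smooth:
  assumes \<eta>: "configuration k \<eta>" and V: "third_prolongation k \<eta> V jV" and W: "third_prolongation k \<eta> W jW"
  shows "smooth_on UNIV (\<lambda>z. omega \<nu> (FL (jet3 \<eta> z)) (TFL jV (jet3 \<eta> z)) (TFL jW (jet3 \<eta> z)))"
proof -
  have J: "smooth_on UNIV (jet3 \<eta>)"
    by (rule smooth_on_jet3[OF configuration_smooth[OF \<eta>]])
  have "smooth_on UNIV jV" "smooth_on UNIV jW"
    using V W by (simp_all add: third_prolongation_def invariant_field_def smooth_iff_smooth_on)
  then have w: "smooth_on UNIV (\<lambda>z. jV (jet3 \<eta> z))" "smooth_on UNIV (\<lambda>z. jW (jet3 \<eta> z))"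
    by (auto intro: smooth_on_compose[OF _ open_UNIV J])
  have T: "smooth_on UNIV (\<lambda>z. TFL jV (jet3 \<eta> z))" "smooth_on UNIV (\<lambda>z. TFL jW (jet3 \<eta> z))"
    unfolding TFL_def
    by (rule smooth_on_derivative_along[OF open_UNIV smooth_on_FL J jet3_regular[OF \<eta>]], rule w)+
  show ?thesis
    using index2_exhaust[of \<nu>]
    by (elim disjE) (simp_all only: omega_formula, (intro smooth_intros open_UNIV T)+)
qed

section \<open>Loop integrals of one-forms in the plane\<close>

text \<open>
  The Poincare lemma for the plane: the potential is the integral of the form along the segment
  from the origin. Closedness makes its differential in the direction \<open>a\<close> the integral of a
  total derivative in the segment parameter.
\<close>

lemma closed_form_has_potential:
  fixes P Q :: "real^2 \<Rightarrow> real"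
  assumes P: "smooth_on UNIV P" and Q: "smooth_on UNIV Q" and closed: "\<And>z. pd 0 P z = pd 1 Q z"
  shows "\<exists>F. \<forall>z. (F has_derivative (\<lambda>a. P z * a $ 1 + Q z * a $ 0)) (at z)"
proof -
  define e :: "2 \<Rightarrow> (real^2) \<Rightarrow>\<^sub>L real" where "e = (\<lambda>i. Blinfun (\<lambda>a. a $ i))"
  have e: "blinfun_apply (e i) a = a $ i" for i a
    unfolding e_def by (simp add: bounded_linear_Blinfun_apply bounded_linear_vec_nth)
  define D where "D R x t = R (t *\<^sub>R x) + t * (x $ 1 * pd 1 R (t *\<^sub>R x) + x $ 0 * pd 0 R (t *\<^sub>R x))"
    for R :: "real^2 \<Rightarrow> real" and x :: "real^2" and t :: real
  \<comment> \<open>The differential of the integrand in the end point \<open>x\<close>; by closedness its two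
    coefficients are the \<open>t\<close>-derivatives of \<open>t * P (t *\<^sub>R x)\<close> and \<open>t * Q (t *\<^sub>R x)\<close>.\<close>
  define fx where "fx x t = D P x t *\<^sub>R e 1 + D Q x t *\<^sub>R e 0" for x t
  let ?f = "\<lambda>x t. P (t *\<^sub>R x) * x $ 1 + Q (t *\<^sub>R x) * x $ 0"
  have dR: "(R has_derivative (\<lambda>a. a $ 1 * pd 1 R z + a $ 0 * pd 0 R z)) (at z)"
    if "smooth_on UNIV R" for R :: "real^2 \<Rightarrow> real" and z
    using has_derivative_via_pd[OF smooth_on_differentiable[OF that UNIV_I]] by simp
  have along: "((\<lambda>x. R (t *\<^sub>R x)) has_derivative
      (\<lambda>a. t * (a $ 1 * pd 1 R (t *\<^sub>R x) + a $ 0 * pd 0 R (t *\<^sub>R x)))) (at x)"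
    if "smooth_on UNIV R" for R :: "real^2 \<Rightarrow> real" and x t
  proof -
    have "((\<lambda>x. t *\<^sub>R x) has_derivative (\<lambda>a. t *\<^sub>R a)) (at x)"
      by (auto intro!: derivative_eq_intros)
    from has_derivative_compose[OF this dR[OF that]] show ?thesis
      by (simp add: algebra_simps)
  qed
  have nth: "((\<lambda>x. x $ i) has_derivative (\<lambda>a. a $ i)) (at x)" for i :: 2 and x :: "real^2"
    by (rule bounded_linear_imp_has_derivative[OF bounded_linear_vec_nth])
  have 1: "((\<lambda>x. ?f x t) has_derivative blinfun_apply (fx x t)) (at x)" for x t
  proof -
    have "((\<lambda>x. ?f x t) has_derivative (\<lambda>a.
        (P (t *\<^sub>R x) * a $ 1 + t * (a $ 1 * pd 1 P (t *\<^sub>R x) + a $ 0 * pd 0 P (t *\<^sub>R x)) * x $ 1) +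
        (Q (t *\<^sub>R x) * a $ 0 + t * (a $ 1 * pd 1 Q (t *\<^sub>R x) + a $ 0 * pd 0 Q (t *\<^sub>R x)) * x $ 0))) (at x)"
      by (intro has_derivative_add has_derivative_mult along nth P Q)
    moreover have "(\<lambda>a. (P (t *\<^sub>R x) * a $ 1 + t * (a $ 1 * pd 1 P (t *\<^sub>R x) + a $ 0 * pd 0 P (t *\<^sub>R x)) * x $ 1) +
        (Q (t *\<^sub>R x) * a $ 0 + t * (a $ 1 * pd 1 Q (t *\<^sub>R x) + a $ 0 * pd 0 Q (t *\<^sub>R x)) * x $ 0)) = blinfun_apply (fx x t)"
      by (simp add: fun_eq_iff fx_def D_def e closed blinfun.add_left blinfun.scaleR_left algebra_simps)
    ultimately show ?thesis by simp
  qed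
  have cont: "continuous_on UNIV (\<lambda>(x, t). R (t *\<^sub>R x))" if "smooth_on UNIV R" for R :: "real^2 \<Rightarrow> real"
  proof -
    have "continuous_on UNIV (\<lambda>p :: (real^2) \<times> real. snd p *\<^sub>R fst p)"
      by (intro continuous_intros)
    from continuous_on_compose2[OF smooth_on_continuous[OF that] this subset_UNIV] show ?thesis
      by (simp add: case_prod_unfold)
  qed
  have 2: "continuous_on (UNIV \<times> cbox 0 1) (\<lambda>(x, t). fx x t)"
  proof -
    note c = cont[unfolded case_prod_unfold]
    have "continuous_on UNIV (\<lambda>p. fx (fst p) (snd p))"
      unfolding fx_def D_def by (intro continuous_intros c P Q smooth_on_pd)
    then show ?thesis
      unfolding case_prod_unfold by (rule continuous_on_subset) (rule subset_UNIV)
  qed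
  have 3: "?f x integrable_on cbox 0 1" for x
  proof (rule integrable_continuous)
    have c: "continuous_on (cbox 0 1) (\<lambda>t. R (t *\<^sub>R x))" if "smooth_on UNIV R" for R :: "real^2 \<Rightarrow> real"
      by (rule continuous_on_compose2[OF smooth_on_continuous[OF that] _ subset_UNIV]) (intro continuous_intros)
    show "continuous_on (cbox 0 1) (?f x)"
      by (intro continuous_intros c P Q)
  qed
  have 4: "(fx x has_integral (P x *\<^sub>R e 1 + Q x *\<^sub>R e 0)) (cbox 0 1)" for x
  proof -
    have r: "((\<lambda>t. t * R (t *\<^sub>R x)) has_real_derivative D R x t) (at t within {0..1})"
      if "smooth_on UNIV R" for R :: "real^2 \<Rightarrow> real" and t
    proof -
      have "((\<lambda>t. t *\<^sub>R x) has_derivative (\<lambda>h. h *\<^sub>R x)) (at t)"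
        by (auto intro!: derivative_eq_intros)
      from has_derivative_compose[OF this dR[OF that]]
      have "((\<lambda>t. R (t *\<^sub>R x)) has_real_derivative (x $ 1 * pd 1 R (t *\<^sub>R x) + x $ 0 * pd 0 R (t *\<^sub>R x))) (at t)"
        by (auto simp: has_field_derivative_def algebra_simps elim!: has_derivative_eq_rhs)
      from DERIV_mult[OF DERIV_ident this] show ?thesis
        by (auto simp: D_def mult.commute intro: has_field_derivative_at_within)
    qed
    have "((\<lambda>t. (t * P (t *\<^sub>R x)) *\<^sub>R e 1 + (t * Q (t *\<^sub>R x)) *\<^sub>R e 0) has_vector_derivative fx x t)
        (at t within {0..1})" for t
      using has_vector_derivative_add[OF has_vector_derivative_scaleR[OF r[OF P] has_vector_derivative_const]
          has_vector_derivative_scaleR[OF r[OF Q] has_vector_derivative_const]]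
      by (simp add: fx_def)
    from fundamental_theorem_of_calculus[OF zero_le_one this]
    show ?thesis by simp
  qed
  have "((\<lambda>x. integral (cbox 0 1) (?f x)) has_derivative (\<lambda>a. P z * a $ 1 + Q z * a $ 0)) (at z)" for z
  proof -
    have "((\<lambda>x. integral (cbox 0 1) (?f x)) has_derivative blinfun_apply (integral (cbox 0 1) (fx z))) (at z)"
      by (rule leibniz_rule[OF 1 3 2 UNIV_I convex_UNIV])
    moreover have "blinfun_apply (integral (cbox 0 1) (fx z)) = (\<lambda>a. P z * a $ 1 + Q z * a $ 0)"
      unfolding integral_unique[OF 4] by (simp add: fun_eq_iff blinfun.add_left blinfun.scaleR_left e)
    ultimately show ?thesis by simp
  qed
  then show ?thesis by blast
qed

text \<open>
  The integrand is the derivative of the potential along the path, except at finitely many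
  corners.
\<close>

lemma exact_form_loop_integral:
  fixes P Q F :: "real^2 \<Rightarrow> real"
  assumes F: "\<And>z. (F has_derivative (\<lambda>a. P z * a $ 1 + Q z * a $ 0)) (at z)"
    and \<gamma>: "valid_path \<gamma>" "pathfinish \<gamma> = pathstart \<gamma>"
  defines "v \<equiv> \<lambda>s. vector_derivative \<gamma> (at s within {0..1})"
  shows "((\<lambda>s. P (\<gamma> s) * v s $ 1 + Q (\<gamma> s) * v s $ 0) has_integral 0) {0..1}"
proof -
  have "\<gamma> piecewise_C1_differentiable_on {0..1}"
    using \<gamma>(1) by (simp add: valid_path_def)
  then obtain S where cont: "continuous_on {0..1} \<gamma>" and S: "finite S" "\<gamma> C1_differentiable_on ({0..1} - S)"
    unfolding piecewise_C1_differentiable_on_def by blast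
  obtain D where D: "\<And>s. s \<in> {0..1} - S \<Longrightarrow> (\<gamma> has_vector_derivative D s) (at s)"
    using S(2) unfolding C1_differentiable_on_def by blast
  have "((\<lambda>s. F (\<gamma> s)) has_vector_derivative P (\<gamma> s) * v s $ 1 + Q (\<gamma> s) * v s $ 0) (at s)"
    if s: "s \<in> {0<..<1} - S" for s
  proof -
    have "(\<gamma> has_vector_derivative v s) (at s)"
      using D[of s] s vector_derivative_at_within_ivl[OF D[of s], of 0 1] by (simp add: v_def)
    then have "(\<gamma> has_derivative (\<lambda>h. h *\<^sub>R v s)) (at s)"
      by (simp add: has_vector_derivative_def)
    from has_derivative_compose[OF this F] show ?thesis
      by (simp add: has_vector_derivative_def algebra_simps)
  qed
  moreover have "continuous_on {0..1} (\<lambda>s. F (\<gamma> s))"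
    by (rule continuous_on_compose2[OF continuous_at_imp_continuous_on cont subset_UNIV])
      (simp add: has_derivative_continuous[OF F])
  ultimately have "((\<lambda>s. P (\<gamma> s) * v s $ 1 + Q (\<gamma> s) * v s $ 0) has_integral (F (\<gamma> 1) - F (\<gamma> 0))) {0..1}"
    by (rule fundamental_theorem_of_calculus_interior_strong[OF S(1) zero_le_one])
  then show ?thesis
    using \<gamma>(2) by (simp add: pathfinish_def pathstart_def)
qed

definition circle :: "real^2 \<Rightarrow> real \<Rightarrow> real \<Rightarrow> real^2" where
  "circle z r s = z + (r * cos (2 * pi * s)) *\<^sub>R axis 1 1 + (r * sin (2 * pi * s)) *\<^sub>R axis 0 1"

lemma circle_nth: "circle z r s $ 1 = z $ 1 + r * cos (2 * pi * s)" "circle z r s $ 0 = z $ 0 + r * sin (2 * pi * s)"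
  by (simp_all add: circle_def axis_def)

definition circle_velocity :: "real \<Rightarrow> real \<Rightarrow> real^2" where
  "circle_velocity r s = (- 2 * pi * r * sin (2 * pi * s)) *\<^sub>R axis 1 1 + (2 * pi * r * cos (2 * pi * s)) *\<^sub>R axis 0 1"

lemma circle_has_vector_derivative: "(circle z r has_vector_derivative circle_velocity r s) (at s)"
proof -
  have c: "((\<lambda>s. r * cos (2 * pi * s)) has_real_derivative - 2 * pi * r * sin (2 * pi * s)) (at s)"
    and s: "((\<lambda>s. r * sin (2 * pi * s)) has_real_derivative 2 * pi * r * cos (2 * pi * s)) (at s)"
    by (auto intro!: derivative_eq_intros)
  show ?thesis
    unfolding circle_def[abs_def] circle_velocity_def
    using has_vector_derivative_add[OF has_vector_derivative_add[OF has_vector_derivative_const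
          has_vector_derivative_scaleR[OF c has_vector_derivative_const]]
        has_vector_derivative_scaleR[OF s has_vector_derivative_const], of z "axis 1 1" "axis 0 1"]
    by simp
qed

lemma circle_velocity_nth:
  "circle_velocity r s $ 1 = - 2 * pi * r * sin (2 * pi * s)" "circle_velocity r s $ 0 = 2 * pi * r * cos (2 * pi * s)"
  by (simp_all add: circle_velocity_def axis_def)

lemma circle_loop:
  assumes r: "r > 0"
  shows "valid_path (circle z r)" "simple_path (circle z r)" "pathfinish (circle z r) = pathstart (circle z r)"
proof -
  have "circle z r C1_differentiable_on {0..1}"
    unfolding C1_differentiable_on_def
  proof (intro exI conjI ballI)
    show "(circle z r has_vector_derivative circle_velocity r s) (at s)" for s
      by (rule circle_has_vector_derivative)
    show "continuous_on {0..1} (circle_velocity r)"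
      unfolding circle_velocity_def by (intro continuous_intros)
  qed
  then show v: "valid_path (circle z r)"
    by (simp add: valid_path_def C1_differentiable_imp_piecewise)
  show "pathfinish (circle z r) = pathstart (circle z r)"
    by (simp add: pathfinish_def pathstart_def circle_def)
  have "x = y \<or> x = 0 \<and> y = 1 \<or> x = 1 \<and> y = 0"
    if x: "x \<in> {0..1}" and y: "y \<in> {0..1}" and eq: "circle z r x = circle z r y" for x y
  proof -
    have "cos (2 * pi * x) = cos (2 * pi * y)" "sin (2 * pi * x) = sin (2 * pi * y)"
      using arg_cong[OF eq, of "\<lambda>v. v $ 1"] arg_cong[OF eq, of "\<lambda>v. v $ 0"] r by (simp_all add: circle_nth)
    then obtain n :: int where "2 * pi * x = 2 * pi * y + 2 * pi * n"
      using sin_cos_eq_iff[of "2 * pi * x" "2 * pi * y"] by auto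
    then have "2 * pi * x = 2 * pi * (y + n)" by (simp add: distrib_left)
    then have n: "x = y + n" by simp
    then have "\<bar>real_of_int n\<bar> \<le> 1" using x y by auto
    then have "n = 0 \<or> n = 1 \<or> n = -1" by linarith
    then show ?thesis using n x y by auto
  qed
  then show "simple_path (circle z r)"
    using valid_path_imp_path[OF v] by (simp add: simple_path_def loop_free_def)
qed

text \<open>
  On a circle of radius \<open>r\<close> the linear part of the form integrates to \<open>\<pi> r\<^sup>2\<close> times its curl, while
  the remainder of the first-order expansion contributes at most \<open>4 \<pi> r\<^sup>2 \<epsilon>\<close>. Thus the curl at the
  centre is bounded by every \<open>4 \<epsilon>\<close>.
\<close>

lemma curl_free_if_circle_integrals_vanish:
  fixes P Q :: "real^2 \<Rightarrow> real"
  assumes dP: "(P has_derivative (\<lambda>a. Px * a $ 1 + Pt * a $ 0)) (at z)"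
    and dQ: "(Q has_derivative (\<lambda>a. Qx * a $ 1 + Qt * a $ 0)) (at z)"
    and loops: "\<And>r. r > 0 \<Longrightarrow> ((\<lambda>s. P (circle z r s) * circle_velocity r s $ 1
      + Q (circle z r s) * circle_velocity r s $ 0) has_integral 0) {0..1}"
  shows "Pt = Qx"
proof -
  have "\<bar>Qx - Pt\<bar> \<le> 4 * \<epsilon>" if \<epsilon>: "\<epsilon> > 0" for \<epsilon>
  proof -
    from dP[unfolded has_derivative_at_alt] \<epsilon> obtain d1 where d1: "d1 > 0"
      "\<And>y. norm (y - z) < d1 \<Longrightarrow> norm (P y - P z - (Px * (y - z) $ 1 + Pt * (y - z) $ 0)) \<le> \<epsilon> * norm (y - z)"
      by blast
    from dQ[unfolded has_derivative_at_alt] \<epsilon> obtain d2 where d2: "d2 > 0"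
      "\<And>y. norm (y - z) < d2 \<Longrightarrow> norm (Q y - Q z - (Qx * (y - z) $ 1 + Qt * (y - z) $ 0)) \<le> \<epsilon> * norm (y - z)"
      by blast
    define r where "r = min d1 d2 / 2"
    have r: "r > 0" "r < d1" "r < d2" using d1 d2 by (auto simp: r_def)
    define \<theta> where "\<theta> s = 2 * pi * s" for s :: real
    define c1 where "c1 = (Qt - Px) * r\<^sup>2 / 2"
    define c2 where "c2 = (Qx - Pt) * r\<^sup>2 / 2"
    define c3 where "c3 = (Qx + Pt) * r\<^sup>2 / 2"
    \<comment> \<open>An antiderivative of the first-order expansion of the form along the circle.\<close>
    define A where "A s = r * P z * cos (\<theta> s) + r * Q z * sin (\<theta> s) + c1 * (sin (\<theta> s))\<^sup>2
      + c2 * \<theta> s + c3 * (sin (\<theta> s) * cos (\<theta> s))" for s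
    define lP where "lP s = P z + Px * (r * cos (\<theta> s)) + Pt * (r * sin (\<theta> s))" for s
    define lQ where "lQ s = Q z + Qx * (r * cos (\<theta> s)) + Qt * (r * sin (\<theta> s))" for s
    have "(A has_real_derivative lP s * circle_velocity r s $ 1 + lQ s * circle_velocity r s $ 0) (at s)" for s
    proof -
      have th: "(\<theta> has_real_derivative 2 * pi) (at s)"
        unfolding \<theta>_def by (auto intro!: derivative_eq_intros)
      have sq: "(cos (\<theta> s))\<^sup>2 = 1 - (sin (\<theta> s))\<^sup>2" by (rule cos_squared_eq)
      have dA: "(A has_real_derivative
          - (r * P z * (sin (\<theta> s) * (2 * pi))) + r * Q z * (cos (\<theta> s) * (2 * pi))
          + c1 * (2 * sin (\<theta> s) * (cos (\<theta> s) * (2 * pi))) + c2 * (2 * pi)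
          + c3 * ((cos (\<theta> s))\<^sup>2 * (2 * pi) - (sin (\<theta> s))\<^sup>2 * (2 * pi))) (at s)"
        unfolding A_def[abs_def]
        by (rule derivative_eq_intros th refl)+ (simp add: power2_eq_square algebra_simps)
      have ident: "- (r * P z * (a * (2 * pi))) + r * Q z * (b * (2 * pi)) + c1 * (2 * a * (b * (2 * pi)))
          + c2 * (2 * pi) + c3 * (b\<^sup>2 * (2 * pi) - a\<^sup>2 * (2 * pi))
        = (P z + Px * (r * b) + Pt * (r * a)) * (- 2 * pi * r * a)
          + (Q z + Qx * (r * b) + Qt * (r * a)) * (2 * pi * r * b)" if "b\<^sup>2 = 1 - a\<^sup>2" for a b
      proof -
        have "- (r * P z * (a * (2 * pi))) + r * Q z * (b * (2 * pi)) + c1 * (2 * a * (b * (2 * pi)))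
            + c2 * (2 * pi) + c3 * (b\<^sup>2 * (2 * pi) - a\<^sup>2 * (2 * pi))
          = (P z + Px * (r * b) + Pt * (r * a)) * (- 2 * pi * r * a)
            + (Q z + Qx * (r * b) + Qt * (r * a)) * (2 * pi * r * b)
            + pi * r\<^sup>2 * (Qx - Pt) * (1 - a\<^sup>2 - b\<^sup>2)"
          unfolding c1_def c2_def c3_def by (simp add: field_simps power2_eq_square)
        moreover have "1 - a\<^sup>2 - b\<^sup>2 = 0" using that by simp
        ultimately show ?thesis by (simp only: mult_zero_right add_0_right)
      qed
      from ident[OF sq] have "- (r * P z * (sin (\<theta> s) * (2 * pi))) + r * Q z * (cos (\<theta> s) * (2 * pi))
          + c1 * (2 * sin (\<theta> s) * (cos (\<theta> s) * (2 * pi))) + c2 * (2 * pi)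
          + c3 * ((cos (\<theta> s))\<^sup>2 * (2 * pi) - (sin (\<theta> s))\<^sup>2 * (2 * pi))
        = lP s * circle_velocity r s $ 1 + lQ s * circle_velocity r s $ 0"
        unfolding lP_def lQ_def circle_velocity_nth \<theta>_def[of s, symmetric] .
      from dA[unfolded this] show ?thesis .
    qed
    then have lin: "((\<lambda>s. lP s * circle_velocity r s $ 1 + lQ s * circle_velocity r s $ 0) has_integral (A 1 - A 0)) {0..1}"
      by (intro fundamental_theorem_of_calculus zero_le_one)
        (simp only: has_real_derivative_iff_has_vector_derivative[symmetric] has_field_derivative_at_within)
    have A10: "A 1 - A 0 = (Qx - Pt) * r\<^sup>2 * pi"
      by (simp add: A_def \<theta>_def c2_def)
    have rem: "((\<lambda>s. (P (circle z r s) * circle_velocity r s $ 1 + Q (circle z r s) * circle_velocity r s $ 0)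
        - (lP s * circle_velocity r s $ 1 + lQ s * circle_velocity r s $ 0)) has_integral (0 - (Qx - Pt) * r\<^sup>2 * pi)) {0..1}"
      using has_integral_diff[OF loops[OF r(1)] lin[unfolded A10]] .
    have bound: "norm ((P (circle z r s) * circle_velocity r s $ 1 + Q (circle z r s) * circle_velocity r s $ 0)
        - (lP s * circle_velocity r s $ 1 + lQ s * circle_velocity r s $ 0)) \<le> 4 * pi * r\<^sup>2 * \<epsilon>" for s
    proof -
      let ?y = "circle z r s"
      have nth: "(?y - z) $ 1 = r * cos (\<theta> s)" "(?y - z) $ 0 = r * sin (\<theta> s)"
        by (simp_all add: circle_nth \<theta>_def)
      have "(norm (?y - z))\<^sup>2 = (r * cos (\<theta> s))\<^sup>2 + (r * sin (\<theta> s))\<^sup>2"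
        unfolding power2_norm_eq_inner inner_vec_def sum_index2 nth by (simp add: power2_eq_square)
      also have "\<dots> = r\<^sup>2"
        by (simp add: power_mult_distrib flip: distrib_left)
      finally have n: "norm (?y - z) = r" using r(1) by (simp add: power2_eq_iff_nonneg)
      have p: "\<bar>P ?y - lP s\<bar> \<le> \<epsilon> * r" and q: "\<bar>Q ?y - lQ s\<bar> \<le> \<epsilon> * r"
        using d1(2)[of ?y] d2(2)[of ?y] r unfolding n nth lP_def lQ_def by (simp_all add: algebra_simps)
      have v: "\<bar>circle_velocity r s $ 1\<bar> \<le> 2 * pi * r" "\<bar>circle_velocity r s $ 0\<bar> \<le> 2 * pi * r"
        unfolding circle_velocity_nth using r(1) by (auto simp: abs_mult mult_le_cancel_left1)
      have "\<bar>(P ?y - lP s) * circle_velocity r s $ 1 + (Q ?y - lQ s) * circle_velocity r s $ 0\<bar>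
          \<le> \<bar>P ?y - lP s\<bar> * \<bar>circle_velocity r s $ 1\<bar> + \<bar>Q ?y - lQ s\<bar> * \<bar>circle_velocity r s $ 0\<bar>"
        unfolding abs_mult[symmetric] by (rule abs_triangle_ineq)
      also have "\<dots> \<le> \<epsilon> * r * (2 * pi * r) + \<epsilon> * r * (2 * pi * r)"
        using \<epsilon> r(1) by (intro add_mono mult_mono p q v) auto
      finally show ?thesis by (simp add: algebra_simps power2_eq_square)
    qed
    have "norm (0 - (Qx - Pt) * r\<^sup>2 * pi) \<le> 4 * pi * r\<^sup>2 * \<epsilon>"
      using has_integral_bound_real[OF _ finite.emptyI rem, of "4 * pi * r\<^sup>2 * \<epsilon>"] \<epsilon> bound by simp
    moreover have "norm (0 - (Qx - Pt) * r\<^sup>2 * pi) = (r\<^sup>2 * pi) * \<bar>Qx - Pt\<bar>"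
      by (simp add: abs_mult mult_ac)
    moreover have "4 * pi * r\<^sup>2 * \<epsilon> = (r\<^sup>2 * pi) * (4 * \<epsilon>)"
      by simp
    ultimately have "(r\<^sup>2 * pi) * \<bar>Qx - Pt\<bar> \<le> (r\<^sup>2 * pi) * (4 * \<epsilon>)"
      by linarith
    then show ?thesis
      using r(1) by (simp add: mult_le_cancel_left_pos)
  qed
  from this[of "\<bar>Qx - Pt\<bar> / 8"] show ?thesis by (cases "Qx = Pt") auto
qed

lemma loop_integrals_vanish_iff_closed:
  fixes P Q :: "real^2 \<Rightarrow> real"
  assumes P: "smooth_on UNIV P" and Q: "smooth_on UNIV Q"
  shows "(\<forall>\<gamma>. valid_path \<gamma> \<and> simple_path \<gamma> \<and> pathfinish \<gamma> = pathstart \<gamma> \<longrightarrow>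
      ((\<lambda>s. P (\<gamma> s) * vector_derivative \<gamma> (at s within {0..1}) $ 1
          + Q (\<gamma> s) * vector_derivative \<gamma> (at s within {0..1}) $ 0) has_integral 0) {0..1})
    \<longleftrightarrow> (\<forall>z. pd 0 P z = pd 1 Q z)" (is "?loops \<longleftrightarrow> ?closed")
proof
  assume ?closed
  then obtain F where "\<And>z. (F has_derivative (\<lambda>a. P z * a $ 1 + Q z * a $ 0)) (at z)"
    using closed_form_has_potential[OF P Q] by blast
  then show ?loops
    using exact_form_loop_integral by blast
next
  assume loops: ?loops
  show ?closed
  proof
    fix z
    have d: "(R has_derivative (\<lambda>a. pd 1 R z * a $ 1 + pd 0 R z * a $ 0)) (at z)"
      if "smooth_on UNIV R" for R :: "real^2 \<Rightarrow> real"
      using has_derivative_via_pd[OF smooth_on_differentiable[OF that UNIV_I]] by (simp add: mult.commute)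
    show "pd 0 P z = pd 1 Q z"
    proof (rule curl_free_if_circle_integrals_vanish[OF d[OF P] d[OF Q]])
      fix r :: real assume r: "r > 0"
      have "vector_derivative (circle z r) (at s within {0..1}) = circle_velocity r s" if "s \<in> {0..1}" for s
        by (rule vector_derivative_at_within_ivl[OF circle_has_vector_derivative]) (use that in auto)
      moreover note loops[rule_format, of "circle z r"] circle_loop[OF r]
      ultimately show "((\<lambda>s. P (circle z r s) * circle_velocity r s $ 1
          + Q (circle z r s) * circle_velocity r s $ 0) has_integral 0) {0..1}"
        by (auto elim: has_integral_eq[rotated])
    qed
  qed
qed

lemma form_formula_iff_conservation_law:
  assumes \<eta>: "configuration k \<eta>" and V: "vertical V" "third_prolongation k \<eta> V jV"
    and W: "vertical W" "third_prolongation k \<eta> W jW"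
  shows "multisymplectic_form_formula \<eta> jV jW \<longleftrightarrow> conservation_law \<eta> jV jW"
proof -
  define R where "R \<nu> z = omega \<nu> (FL (jet3 \<eta> z)) (TFL jV (jet3 \<eta> z)) (TFL jW (jet3 \<eta> z))" for \<nu> z
  have R: "smooth_on UNIV (R \<nu>)" for \<nu>
    unfolding R_def by (rule omega_along_jets_smooth[OF \<eta> V(2) W(2)])
  have integrand: "form_integrand \<eta> jV jW z a = R 0 z * a $ 1 + (- R 1 z) * a $ 0" for z a
    unfolding R_def form_integrand_formula[OF \<eta> V W] by simp
  have "pd 0 (R 0) z = pd 1 (\<lambda>z. - R 1 z) z \<longleftrightarrow> pd 1 (R 1) z + pd 0 (R 0) z = 0" for z
    unfolding pd_minus[OF smooth_on_differentiable[OF R UNIV_I]] by linarith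
  then show ?thesis
    unfolding multisymplectic_form_formula_def integrand
      loop_integrals_vanish_iff_closed[OF R smooth_on_minus[OF open_UNIV R]] conservation_law_def R_def[symmetric]
    by simp
qed

section \<open>Eulerian and Lagrangian equation\<close>

text \<open>
  The chain rule for an Eulerian quantity \<open>F\<close> carried along by the flow; its time derivative is
  the material derivative.
\<close>

lemma pd_compose_flow_map:
  fixes \<eta> F :: "real^2 \<Rightarrow> real"
  assumes \<eta>: "smooth_on UNIV \<eta>" and F: "smooth_on UNIV F"
  defines "\<Phi> \<equiv> \<lambda>z. \<chi> \<mu>::2. if \<mu> = 1 then \<eta> z else z $ 0"
  shows "pd 1 (\<lambda>z. F (\<Phi> z)) = (\<lambda>z. pd 1 F (\<Phi> z) * pd 1 \<eta> z)"
    "pd 0 (\<lambda>z. F (\<Phi> z)) = (\<lambda>z. pd 1 F (\<Phi> z) * pd 0 \<eta> z + pd 0 F (\<Phi> z))"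
    "smooth_on UNIV (\<lambda>z. F (\<Phi> z))"
proof -
  have \<Phi>: "\<Phi> = (\<lambda>z. \<eta> z *\<^sub>R axis 1 1 + z $ 0 *\<^sub>R axis 0 1)"
    using index2_exhaust by (auto simp: \<Phi>_def fun_eq_iff vec_eq_iff axis_def)
  have "smooth_on UNIV \<Phi>"
    unfolding \<Phi> by (intro smooth_intros \<eta> open_UNIV)
  then show "smooth_on UNIV (\<lambda>z. F (\<Phi> z))"
    by (rule smooth_on_compose[OF F open_UNIV]) simp
  have chain: "pd \<mu> (\<lambda>z. F (\<Phi> z)) z = pd 1 F (\<Phi> z) * pd \<mu> \<eta> z + pd 0 F (\<Phi> z) * axis \<mu> 1 $ 0" for \<mu> z
  proof -
    have "(\<Phi> has_derivative (\<lambda>a. frechet_derivative \<eta> (at z) a *\<^sub>R axis 1 1 + a $ 0 *\<^sub>R axis 0 1)) (at z)"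
      unfolding \<Phi> by (intro has_derivative_add has_derivative_scaleR_left
          smooth_on_has_derivative[OF \<eta> UNIV_I] bounded_linear_imp_has_derivative[OF bounded_linear_vec_nth])
    from pd_eqI[OF has_derivative_compose[OF this has_derivative_via_pd[OF smooth_on_differentiable[OF F UNIV_I]]], of \<mu>]
    show ?thesis by (simp add: pd_def axis_def mult.commute)
  qed
  show "pd 1 (\<lambda>z. F (\<Phi> z)) = (\<lambda>z. pd 1 F (\<Phi> z) * pd 1 \<eta> z)"
    by (rule ext) (simp add: chain axis_def)
  show "pd 0 (\<lambda>z. F (\<Phi> z)) = (\<lambda>z. pd 1 F (\<Phi> z) * pd 0 \<eta> z + pd 0 F (\<Phi> z))"
    by (rule ext) (simp add: chain axis_def)
qed

text \<open>
  By Rolle's theorem \<open>\<eta>\<^sub>x \<noteq> 0\<close> excludes degree zero. The lift then gains the nonzero integer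
  \<open>k\<close> over each period, so it is unbounded in both directions and takes every value.
\<close>

lemma configuration_onto_fibre:
  assumes \<eta>: "configuration k \<eta>"
  obtains x where "\<eta> (x *\<^sub>R axis 1 1 + t *\<^sub>R axis 0 1) = y"
proof -
  define g where "g x = \<eta> (x *\<^sub>R axis 1 1 + t *\<^sub>R axis 0 1)" for x
  have deck: "\<eta> (z + deckX) = \<eta> z + of_int k" and nz: "pd 1 \<eta> z \<noteq> 0" for z
    using \<eta> by (simp_all add: configuration_def bundle_section_def)
  have g_period: "g (x + real n) = g x + real n * of_int k" for x n
  proof (induction n)
    case (Suc n)
    have "g (x + real (Suc n)) = \<eta> ((x + real n) *\<^sub>R axis 1 1 + t *\<^sub>R axis 0 1 + deckX)"
      by (simp add: g_def deckX_def algebra_simps)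
    also have "\<dots> = g (x + real n) + of_int k"
      unfolding deck by (simp add: g_def)
    finally show ?case by (simp add: Suc algebra_simps)
  qed simp
  have g': "(g has_real_derivative pd 1 \<eta> (x *\<^sub>R axis 1 1 + t *\<^sub>R axis 0 1)) (at x)" for x
    using pd_has_real_derivative_axis[OF smooth_on_differentiable[OF configuration_smooth[OF \<eta>] UNIV_I],
        where z = "t *\<^sub>R axis 0 1" and s = x and \<mu> = 1]
    by (simp add: has_real_derivative_iff_has_vector_derivative g_def[abs_def] add.commute)
  have "k \<noteq> 0"
  proof
    assume "k = 0"
    then have "g 1 = g 0" using g_period[of 0 1] by simp
    moreover obtain x where "g 1 - g 0 = (1 - 0) * pd 1 \<eta> (x *\<^sub>R axis 1 1 + t *\<^sub>R axis 0 1)"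
      using MVT2[of 0 1 g, OF zero_less_one g'] by blast
    ultimately show False using nz by simp
  qed
  obtain n :: nat where n: "\<bar>y - g 0\<bar> \<le> real n"
    using real_arch_simple by blast
  have "real n * 1 \<le> real n * \<bar>real_of_int k\<bar>"
    using \<open>k \<noteq> 0\<close> by (intro mult_left_mono) linarith+
  then have nk: "real n \<le> \<bar>real n * real_of_int k\<bar>"
    by (simp add: abs_mult)
  have gn: "g (real n) = g 0 + real n * of_int k" "g (- real n) = g 0 - real n * of_int k"
    using g_period[of 0 n] g_period[of "- real n" n] by simp_all
  have "connected (range g)"
    by (rule connected_continuous_image[OF _ connected_UNIV])
      (use g' DERIV_isCont continuous_at_imp_continuous_on in blast)
  then have "y \<in> range g"
  proof (cases "real n * of_int k \<ge> 0")
    case True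
    then have "g (- real n) \<le> y" "y \<le> g (real n)" using n nk gn by linarith+
    then show ?thesis using connectedD_interval[OF \<open>connected (range g)\<close>] by blast
  next
    case False
    then have "g (real n) \<le> y" "y \<le> g (- real n)" using n nk gn by linarith+
    then show ?thesis using connectedD_interval[OF \<open>connected (range g)\<close>] by blast
  qed
  then show thesis using that by (auto simp: g_def)
qed

text \<open>
  With \<open>\<eta>\<^sub>t = u \<circ> \<Phi>\<close> one has \<open>\<eta>\<^sub>t\<^sub>x / \<eta>\<^sub>x = u\<^sub>y \<circ> \<Phi>\<close>, so every term of the Lagrangian equation is
  \<open>\<eta>\<^sub>x\<close> times a function of \<open>u\<close> and its derivatives at \<open>\<Phi>\<close>, and their sum is minus the defect
  \<open>\<E>\<close> of the Eulerian equation.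
\<close>

lemma euler_iff_lagrange:
  assumes \<eta>: "configuration k \<eta>" and u: "smooth u" and flow: "lagrangian_flow_of u \<eta>"
  shows "CH_eulerian u \<longleftrightarrow> CH_lagrangian \<eta>"
proof -
  define \<Phi> :: "real^2 \<Rightarrow> real^2" where "\<Phi> z = (\<chi> \<mu>. if \<mu> = 1 then \<eta> z else z $ 0)" for z
  define \<E> where "\<E> q = pd 0 u q - pd 0 (pd 1 (pd 1 u)) q
    - (- 3 * u q * pd 1 u q + 2 * pd 1 u q * pd 1 (pd 1 u) q + u q * pd 1 (pd 1 (pd 1 u)) q)" for q
  have s\<eta>: "smooth_on UNIV \<eta>" and nz: "pd 1 \<eta> z \<noteq> 0" for z
    using configuration_smooth[OF \<eta>] \<eta> by (simp_all add: configuration_def)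
  have su: "smooth_on UNIV u" using u by (simp add: smooth_iff_smooth_on)
  note chain = pd_compose_flow_map[OF s\<eta>, folded \<Phi>_def]
  have d: "F differentiable at z" if "smooth_on UNIV F" for F :: "real^2 \<Rightarrow> real" and z
    by (rule smooth_on_differentiable[OF that UNIV_I])
  have su1: "smooth_on UNIV (pd 1 u)" and su2: "smooth_on UNIV (pd 1 (pd 1 u))" and s\<eta>1: "smooth_on UNIV (pd 1 \<eta>)"
    by (intro smooth_on_pd su s\<eta>)+
  have \<eta>t: "pd 0 \<eta> = (\<lambda>z. u (\<Phi> z))"
    using flow by (simp add: lagrangian_flow_of_def \<Phi>_def fun_eq_iff)
  have \<eta>tx: "pd 1 (\<lambda>z. u (\<Phi> z)) = (\<lambda>z. pd 1 u (\<Phi> z) * pd 1 \<eta> z)"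
    by (rule chain(1)[OF su])
  have \<eta>xt: "pd 0 (pd 1 \<eta>) z = pd 1 u (\<Phi> z) * pd 1 \<eta> z" for z
    unfolding pd_commute[OF s\<eta>, of 0] \<eta>t \<eta>tx ..
  note dc = d[OF chain(3)[OF su]] d[OF chain(3)[OF su1]] d[OF chain(3)[OF su2]] d[OF s\<eta>1]
  have 1: "pd 1 (\<lambda>z. (pd 1 u (\<Phi> z))\<^sup>2 - (u (\<Phi> z))\<^sup>2) z =
      2 * pd 1 u (\<Phi> z) * (pd 1 (pd 1 u) (\<Phi> z) * pd 1 \<eta> z) - 2 * u (\<Phi> z) * (pd 1 u (\<Phi> z) * pd 1 \<eta> z)" for z
    by (simp only: pd_diff[OF differentiable_power[OF dc(2)] differentiable_power[OF dc(1)]]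
        pd_power2[OF dc(1)] pd_power2[OF dc(2)] chain(1)[OF su] chain(1)[OF su1])
  have 2: "pd 0 (\<lambda>z. pd 1 \<eta> z * u (\<Phi> z)) z =
      pd 1 \<eta> z * (pd 1 u (\<Phi> z) * u (\<Phi> z) + pd 0 u (\<Phi> z)) + pd 1 u (\<Phi> z) * pd 1 \<eta> z * u (\<Phi> z)" for z
    by (simp only: pd_mult[OF dc(4,1)] chain(2)[OF su] \<eta>xt \<eta>t)
  have 3: "pd 0 (\<lambda>z. pd 1 (pd 1 u) (\<Phi> z) * pd 1 \<eta> z) z =
      pd 1 (pd 1 u) (\<Phi> z) * (pd 1 u (\<Phi> z) * pd 1 \<eta> z)
      + (pd 1 (pd 1 (pd 1 u)) (\<Phi> z) * u (\<Phi> z) + pd 0 (pd 1 (pd 1 u)) (\<Phi> z)) * pd 1 \<eta> z" for z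
    by (simp only: pd_mult[OF dc(3,4)] chain(2)[OF su2] \<eta>xt \<eta>t)
  have "CH_lagrangian \<eta> \<longleftrightarrow> (\<forall>z. \<E> (\<Phi> z) * pd 1 \<eta> z = 0)"
  proof -
    have q: "(\<lambda>z. pd 1 u (\<Phi> z) * pd 1 \<eta> z / pd 1 \<eta> z) = (\<lambda>z. pd 1 u (\<Phi> z))"
      using nz by simp
    have "1/2 * pd 1 (\<lambda>z. (pd 1 u (\<Phi> z))\<^sup>2 - (u (\<Phi> z))\<^sup>2) z - pd 0 (\<lambda>z. pd 1 \<eta> z * u (\<Phi> z)) z
        + pd 0 (pd 1 (\<lambda>z. pd 1 u (\<Phi> z))) z = - (\<E> (\<Phi> z) * pd 1 \<eta> z)" for z
      unfolding chain(1)[OF su1] 1 2 3 \<E>_def by (simp add: algebra_simps)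
    moreover have "pd 1 u (\<Phi> z) * pd 1 \<eta> z / pd 1 \<eta> z = pd 1 u (\<Phi> z)" for z
      using nz by simp
    ultimately show ?thesis
      unfolding CH_lagrangian_def Let_def \<eta>t \<eta>tx by simp
  qed
  also have "\<dots> \<longleftrightarrow> (\<forall>q. \<E> q = 0)"
  proof -
    have "\<exists>z. \<Phi> z = q" for q
    proof -
      obtain x where x: "\<eta> (x *\<^sub>R axis 1 1 + q $ 0 *\<^sub>R axis 0 1) = q $ 1"
        by (rule configuration_onto_fibre[OF \<eta>])
      have "\<Phi> (x *\<^sub>R axis 1 1 + q $ 0 *\<^sub>R axis 0 1) = q"
        using x index2_exhaust by (auto simp: \<Phi>_def vec_eq_iff axis_def)
      then show ?thesis by blast
    qed
    then show ?thesis using nz by (metis mult_eq_0_iff)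
  qed
  also have "\<dots> \<longleftrightarrow> CH_eulerian u"
    by (simp only: \<E>_def CH_eulerian_def right_minus_eq)
  finally show ?thesis by simp
qed

section \<open>The Hamiltonian system on the momentum phase space\<close>

lemma grad_eqI:
  assumes "(f has_derivative (\<lambda>h. h \<bullet> D)) (at p)"
  shows "grad f p = D"
  unfolding grad_def gderiv_def
proof (rule the_equality[where P = "\<lambda>D. (f has_derivative (\<lambda>h. h \<bullet> D)) (at p)", OF assms])
  fix D' assume "(f has_derivative (\<lambda>h. h \<bullet> D')) (at p)"
  from fun_cong[OF has_derivative_unique[OF this assms]] show "D' = D"
    by (metis inner_commute vector_eq_rdot)
qed

lemma grad_H: "grad H Z = vector [0, 1/2 * ((Z $ 3)\<^sup>2 - (Z $ 6)\<^sup>2) - Z $ 4, Z $ 2 * Z $ 3 - Z $ 5,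
  - Z $ 2, - Z $ 3, - (Z $ 2 * Z $ 6)]"
proof (rule grad_eqI)
  have nth: "((\<lambda>Z. Z $ i) has_derivative (\<lambda>h. h $ i)) (at Z)" for i :: 6
    by (rule bounded_linear_imp_has_derivative[OF bounded_linear_vec_nth])
  show "(H has_derivative (\<lambda>h. h \<bullet> vector [0, 1/2 * ((Z $ 3)\<^sup>2 - (Z $ 6)\<^sup>2) - Z $ 4, Z $ 2 * Z $ 3 - Z $ 5,
      - Z $ 2, - Z $ 3, - (Z $ 2 * Z $ 6)])) (at Z)"
    unfolding H_formula[abs_def]
    by (rule nth derivative_eq_intros refl)+
      (simp add: fun_eq_iff inner_vec_def sum_6 field_simps power2_eq_square)
qed

text \<open>
  The second components of \<open>B\<^sub>1 Z\<^sub>x\<close> and \<open>B\<^sub>0 Z\<^sub>t\<close> are zero: this equation is the algebraic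
  constraint that defines \<open>p\<^sup>x\<close>.
\<close>

lemma hamiltonian_system_iff:
  "hamiltonian_system Z \<longleftrightarrow> (\<forall>z. pd 1 Z z $ 1 = Z z $ 2 \<and> pd 0 Z z $ 1 = Z z $ 3 \<and>
    pd 1 Z z $ 3 = Z z $ 2 * Z z $ 6 \<and> Z z $ 4 = 1/2 * ((Z z $ 3)\<^sup>2 - (Z z $ 6)\<^sup>2) \<and>
    pd 1 Z z $ 6 = Z z $ 2 * Z z $ 3 - Z z $ 5 \<and> pd 1 Z z $ 4 + pd 0 Z z $ 5 = 0)"
proof -
  have "(\<forall>v. omega 1 (Z z) X v + omega 0 (Z z) T v = grad H (Z z) \<bullet> v) \<longleftrightarrow>
      X $ 1 = Z z $ 2 \<and> T $ 1 = Z z $ 3 \<and> X $ 3 = Z z $ 2 * Z z $ 6 \<and>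
      Z z $ 4 = 1/2 * ((Z z $ 3)\<^sup>2 - (Z z $ 6)\<^sup>2) \<and> X $ 6 = Z z $ 2 * Z z $ 3 - Z z $ 5 \<and> X $ 4 + T $ 5 = 0"
    (is "?all \<longleftrightarrow> ?eqs") for z X T
  proof -
    have "?all \<longleftrightarrow> (\<forall>v. vector [X $ 4 + T $ 5, 0, X $ 6, - X $ 1, - T $ 1, - X $ 3] \<bullet> v = grad H (Z z) \<bullet> v)"
      by (simp add: omega_formula inner_vec_def sum_6 algebra_simps)
    also have "\<dots> \<longleftrightarrow> vector [X $ 4 + T $ 5, 0, X $ 6, - X $ 1, - T $ 1, - X $ 3] = grad H (Z z)"
      using vector_eq_rdot by metis
    also have "\<dots> \<longleftrightarrow> ?eqs"
      unfolding grad_H vec6_eq_iff vector_6 by auto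
    finally show ?thesis .
  qed
  then show ?thesis by (simp only: hamiltonian_system_def)
qed

lemma momenta_along_jet:
  assumes reg: "\<And>z. jet3 \<eta> z \<in> regular_jets" and \<eta>: "smooth_on UNIV \<eta>"
  shows "(\<lambda>z. ptx (jet3 \<eta> z)) = (\<lambda>z. pd 1 (pd 0 \<eta>) z / pd 1 \<eta> z)"
    "(\<lambda>z. px (jet3 \<eta> z)) = (\<lambda>z. 1/2 * ((pd 0 \<eta> z)\<^sup>2 - (pd 1 (pd 0 \<eta>) z / pd 1 \<eta> z)\<^sup>2))"
    "(\<lambda>z. pt (jet3 \<eta> z)) = (\<lambda>z. pd 1 \<eta> z * pd 0 \<eta> z - pd 1 (\<lambda>z. pd 1 (pd 0 \<eta>) z / pd 1 \<eta> z) z)"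
proof -
  have nz: "pd 1 \<eta> z \<noteq> 0" for z
    using reg[of z] by (simp add: regular_jets_def jet3_nth)
  have d: "F differentiable at z" if "smooth_on UNIV F" for F :: "real^2 \<Rightarrow> real" and z
    by (rule smooth_on_differentiable[OF that UNIV_I])
  show "(\<lambda>z. ptx (jet3 \<eta> z)) = (\<lambda>z. pd 1 (pd 0 \<eta>) z / pd 1 \<eta> z)"
    by (simp add: ptx_formula[OF reg] jet3_nth)
  show "(\<lambda>z. px (jet3 \<eta> z)) = (\<lambda>z. 1/2 * ((pd 0 \<eta> z)\<^sup>2 - (pd 1 (pd 0 \<eta>) z / pd 1 \<eta> z)\<^sup>2))"
    by (simp add: px_formula[OF reg] jet3_nth)
  show "(\<lambda>z. pt (jet3 \<eta> z)) = (\<lambda>z. pd 1 \<eta> z * pd 0 \<eta> z - pd 1 (\<lambda>z. pd 1 (pd 0 \<eta>) z / pd 1 \<eta> z) z)"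
    by (simp add: pt_formula[OF reg] jet3_nth
        pd_divide[OF d[OF smooth_on_pd[OF smooth_on_pd[OF \<eta>]]] d[OF smooth_on_pd[OF \<eta>]] nz])
qed

text \<open>
  Along a jet the first five conditions of \<open>hamiltonian_system_iff\<close> hold identically, and the
  last one is the Lagrangian equation with the opposite sign.
\<close>

lemma lagrange_iff_hamilton:
  assumes \<eta>: "configuration k \<eta>"
  shows "CH_lagrangian \<eta> \<longleftrightarrow> hamiltonian_system (\<lambda>z. FL (jet3 \<eta> z))"
proof -
  define q where "q z = pd 1 (pd 0 \<eta>) z / pd 1 \<eta> z" for z
  have reg: "jet3 \<eta> z \<in> regular_jets" for z by (rule jet3_regular[OF \<eta>])
  have s: "smooth_on UNIV \<eta>" by (rule configuration_smooth[OF \<eta>])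
  have nz: "pd 1 \<eta> z \<noteq> 0" for z using \<eta> by (simp add: configuration_def)
  have qe: "pd 1 (pd 0 \<eta>) z = pd 1 \<eta> z * q z" for z by (simp add: q_def nz)
  note mom = momenta_along_jet[OF reg s, folded q_def]
  have d: "F differentiable at z" if "smooth_on UNIV F" for F :: "real^2 \<Rightarrow> real" and z
    by (rule smooth_on_differentiable[OF that UNIV_I])
  have sq: "smooth_on UNIV q"
    unfolding q_def by (intro smooth_intros open_UNIV s nz)
  have sFL: "(\<lambda>z. FL (jet3 \<eta> z)) differentiable at z" for z
    by (rule smooth_on_differentiable[OF smooth_on_compose[OF smooth_on_FL open_UNIV smooth_on_jet3[OF s]] UNIV_I])
      (use reg in blast)
  have 1: "pd 1 (\<lambda>z. 1/2 * ((pd 0 \<eta> z)\<^sup>2 - (q z)\<^sup>2)) z = - (1/2 * pd 1 (\<lambda>z. (q z)\<^sup>2 - (pd 0 \<eta> z)\<^sup>2) z)" for z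
  proof -
    have dd: "(\<lambda>z. (q z)\<^sup>2 - (pd 0 \<eta> z)\<^sup>2) differentiable at z"
      by (intro d smooth_intros sq s open_UNIV)
    have "pd 1 (\<lambda>z. 1/2 * ((pd 0 \<eta> z)\<^sup>2 - (q z)\<^sup>2)) z = pd 1 (\<lambda>z. (- 1/2) * ((q z)\<^sup>2 - (pd 0 \<eta> z)\<^sup>2)) z"
      by (rule arg_cong[where f = "\<lambda>F. pd 1 F z"]) (simp add: fun_eq_iff field_simps)
    then show ?thesis
      unfolding pd_mult[OF differentiable_const dd] pd_const by simp
  qed
  have 2: "pd 0 (\<lambda>z. pd 1 \<eta> z * pd 0 \<eta> z - pd 1 q z) z = pd 0 (\<lambda>z. pd 1 \<eta> z * pd 0 \<eta> z) z - pd 0 (pd 1 q) z" for z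
    by (intro pd_diff d smooth_intros sq s open_UNIV)
  have "hamiltonian_system (\<lambda>z. FL (jet3 \<eta> z)) \<longleftrightarrow>
      (\<forall>z. pd 1 (\<lambda>z. 1/2 * ((pd 0 \<eta> z)\<^sup>2 - (q z)\<^sup>2)) z + pd 0 (\<lambda>z. pd 1 \<eta> z * pd 0 \<eta> z - pd 1 q z) z = 0)"
    unfolding hamiltonian_system_iff pd_vec_nth[OF sFL, symmetric] FL_nth jet3_nth mom fun_cong[OF mom(1)]
      fun_cong[OF mom(2)] fun_cong[OF mom(3)]
    by (simp add: qe)
  also have "\<dots> \<longleftrightarrow> CH_lagrangian \<eta>"
    unfolding 1 2 CH_lagrangian_def Let_def q_def[symmetric] by (intro all_cong1) linarith
  finally show ?thesis by simp
qed

text \<open>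
  The system determines all components of \<open>Z\<close> from the first one: two of its equations
  identify \<open>Z $ 2\<close> and \<open>Z $ 3\<close> with \<open>\<eta>\<^sub>x\<close> and \<open>\<eta>\<^sub>t\<close>, and the next three recover the momenta.
\<close>

lemma hamilton_iff_momenta_of_solution:
  assumes Z: "smooth Z" and deck: "\<And>z. Z (z + deckX) = Z z + deckM k" and nz: "\<And>z. Z z $ 2 \<noteq> 0"
  shows "hamiltonian_system Z \<longleftrightarrow>
    (\<exists>\<eta>. configuration k \<eta> \<and> CH_lagrangian \<eta> \<and> Z = (\<lambda>z. FL (jet3 \<eta> z)))"
proof
  assume H: "hamiltonian_system Z"
  have sZ: "smooth_on UNIV Z" using Z by (simp add: smooth_iff_smooth_on)
  define \<eta> where "\<eta> z = Z z $ 1" for z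
  note sys = H[unfolded hamiltonian_system_iff pd_vec_nth[OF smooth_on_differentiable[OF sZ UNIV_I], symmetric],
      folded \<eta>_def, rule_format]
  have x: "pd 1 \<eta> = (\<lambda>z. Z z $ 2)" and t: "pd 0 \<eta> = (\<lambda>z. Z z $ 3)"
    using sys by auto
  have tx: "pd 1 (pd 0 \<eta>) = (\<lambda>z. Z z $ 2 * Z z $ 6)"
    unfolding t using sys by auto
  have q: "(\<lambda>z. pd 1 (pd 0 \<eta>) z / pd 1 \<eta> z) = (\<lambda>z. Z z $ 6)"
    unfolding tx x using nz by simp
  have s: "smooth_on UNIV \<eta>"
    unfolding \<eta>_def by (intro smooth_intros sZ open_UNIV)
  then have conf: "configuration k \<eta>"
    using nz deck by (simp add: configuration_def bundle_section_def smooth_iff_smooth_on x)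
      (simp add: \<eta>_def deckM_def axis_def)
  note mom = momenta_along_jet[OF jet3_regular[OF conf] s, unfolded q]
  have "Z z = FL (jet3 \<eta> z)" for z
    unfolding vec6_eq_iff FL_nth jet3_nth fun_cong[OF mom(1)] fun_cong[OF mom(2)] fun_cong[OF mom(3)]
    unfolding fun_cong[OF q] x t using sys[of z] nz[of z] by (simp add: \<eta>_def)
  then have eq: "Z = (\<lambda>z. FL (jet3 \<eta> z))" by (rule ext)
  with H conf lagrange_iff_hamilton[OF conf]
  show "\<exists>\<eta>. configuration k \<eta> \<and> CH_lagrangian \<eta> \<and> Z = (\<lambda>z. FL (jet3 \<eta> z))"
    by metis
next
  assume "\<exists>\<eta>. configuration k \<eta> \<and> CH_lagrangian \<eta> \<and> Z = (\<lambda>z. FL (jet3 \<eta> z))"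
  then show "hamiltonian_system Z"
    using lagrange_iff_hamilton by blast
qed

section \<open>Camassa--Holm as a multi-symplectic system\<close>

theorem proposition3p1:
  fixes k :: int
  shows
    "multisymplectic_structure omega
     \<and> (\<forall>\<eta> V W jV jW.
          configuration k \<eta> \<and> variation V \<and> variation W \<and> vertical V \<and> vertical W \<and>
          third_prolongation k \<eta> V jV \<and> third_prolongation k \<eta> W jW \<longrightarrow>
          (\<forall>z a. form_integrand \<eta> jV jW z a =
               omega 0 (FL (jet3 \<eta> z)) (TFL jV (jet3 \<eta> z)) (TFL jW (jet3 \<eta> z)) * a $ 1
             - omega 1 (FL (jet3 \<eta> z)) (TFL jV (jet3 \<eta> z)) (TFL jW (jet3 \<eta> z)) * a $ 0) \<and>
          (multisymplectic_form_formula \<eta> jV jW \<longleftrightarrow> conservation_law \<eta> jV jW))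
     \<and> (\<forall>\<eta> V W jV jW.
          solution k \<eta> \<and> first_variation k \<eta> V \<and> first_variation k \<eta> W \<and>
          vertical V \<and> vertical W \<and>
          third_prolongation k \<eta> V jV \<and> third_prolongation k \<eta> W jW \<longrightarrow>
          conservation_law \<eta> jV jW)
     \<and> (\<forall>p. jy1 p $ 1 \<noteq> 0 \<longrightarrow>
          H (FL p) = L p - px p * jy1 p $ 1 - pt p * jy1 p $ 0 - ptx p * jy2 p $ 0 $ 1)
     \<and> (\<forall>\<eta> u. configuration k \<eta> \<and> smooth u \<and> lagrangian_flow_of u \<eta> \<longrightarrow>
          (CH_eulerian u \<longleftrightarrow> CH_lagrangian \<eta>))
     \<and> (\<forall>\<eta>. configuration k \<eta> \<longrightarrow>
          (CH_lagrangian \<eta> \<longleftrightarrow> hamiltonian_system (\<lambda>z. FL (jet3 \<eta> z))))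
     \<and> (\<forall>Z. smooth Z \<and> (\<forall>z. Z (z + deckX) = Z z + deckM k) \<and> (\<forall>z. Z z $ 2 \<noteq> 0) \<longrightarrow>
          (hamiltonian_system Z \<longleftrightarrow>
             (\<exists>\<eta>. configuration k \<eta> \<and> CH_lagrangian \<eta> \<and> Z = (\<lambda>z. FL (jet3 \<eta> z)))))"
proof (intro conjI)
  show "multisymplectic_structure omega"
    by (rule multisymplectic_structure_omega)
next
  show "\<forall>\<eta> V W jV jW.
      configuration k \<eta> \<and> variation V \<and> variation W \<and> vertical V \<and> vertical W \<and>
      third_prolongation k \<eta> V jV \<and> third_prolongation k \<eta> W jW \<longrightarrow>
      (\<forall>z a. form_integrand \<eta> jV jW z a =
           omega 0 (FL (jet3 \<eta> z)) (TFL jV (jet3 \<eta> z)) (TFL jW (jet3 \<eta> z)) * a $ 1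
         - omega 1 (FL (jet3 \<eta> z)) (TFL jV (jet3 \<eta> z)) (TFL jW (jet3 \<eta> z)) * a $ 0) \<and>
      (multisymplectic_form_formula \<eta> jV jW \<longleftrightarrow> conservation_law \<eta> jV jW)"
    by (intro allI impI conjI, elim conjE, rule form_integrand_formula, assumption+,
        elim conjE, rule form_formula_iff_conservation_law, assumption+)
next
  show "\<forall>\<eta> V W jV jW.
      solution k \<eta> \<and> first_variation k \<eta> V \<and> first_variation k \<eta> W \<and>
      vertical V \<and> vertical W \<and>
      third_prolongation k \<eta> V jV \<and> third_prolongation k \<eta> W jW \<longrightarrow>
      conservation_law \<eta> jV jW"
    unfolding solution_def
    by (intro allI impI, elim conjE, rule first_variations_conservation_law; assumption)
next
  show "\<forall>p. jy1 p $ 1 \<noteq> 0 \<longrightarrow>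
      H (FL p) = L p - px p * jy1 p $ 1 - pt p * jy1 p $ 0 - ptx p * jy2 p $ 0 $ 1"
    using H_FL by (simp add: regular_jets_def)
next
  show "\<forall>\<eta> u. configuration k \<eta> \<and> smooth u \<and> lagrangian_flow_of u \<eta> \<longrightarrow>
      (CH_eulerian u \<longleftrightarrow> CH_lagrangian \<eta>)"
    using euler_iff_lagrange by blast
next
  show "\<forall>\<eta>. configuration k \<eta> \<longrightarrow>
      (CH_lagrangian \<eta> \<longleftrightarrow> hamiltonian_system (\<lambda>z. FL (jet3 \<eta> z)))"
    using lagrange_iff_hamilton by blast
next
  show "\<forall>Z. smooth Z \<and> (\<forall>z. Z (z + deckX) = Z z + deckM k) \<and> (\<forall>z. Z z $ 2 \<noteq> 0) \<longrightarrow>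
      (hamiltonian_system Z \<longleftrightarrow>
         (\<exists>\<eta>. configuration k \<eta> \<and> CH_lagrangian \<eta> \<and> Z = (\<lambda>z. FL (jet3 \<eta> z))))"
    by (intro allI impI, elim conjE, rule hamilton_iff_momenta_of_solution) simp_all
qed

end
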